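(* Let $p$ be an odd prime and let $G$ be a $p$-group of order $p^m$ of rank $5$ belonging to the isoclinism family $\Phi_9$. Then (1) $\displaystyle A_{G}(t/|G|)=\frac{1-p^{-1}}{1-p^{-3}t} + \frac{p^{-1}-p^{-4}}{1-p^{-1}t} + \frac{p^{-4}}{1-t}$; (2) $\displaystyle B_G(t/|G|)=\frac{-p^{-1}}{1-p^{-4}t} + \frac{1}{1-p^{-3}t} + \frac{p^{-1}}{1-p^{-1}t}$.
   Context: For a finite group $G$ and $n\ge 0$, $\alpha_{G,n}$ denotes the number of orbits of $G$ acting on $G^n$ by simultaneous conjugation $g\cdot(x_1,\dots,x_n)=(gx_1g^{-1},\dots,gx_ng^{-1})$, and $\beta_{G,n}$ denotes the number of orbits of the same action on the set $G^{(n)}$ of $n$-tuples of pairwise commuting elements of $G$; $\alpha_{G,0}=\beta_{G,0}=1$. Set $A_G(t)=\sum_{n\ge 0}\alpha_{G,n}t^n$ and $B_G(t)=\sum_{n\ge 0}\beta_{G,n}t^n$ (formal power series, which are rational functions of $t$). $A_G(t/|G|)$, $B_G(t/|G|)$ denote the result of substituting $t/|G|$ for $t$. Finite groups $G,H$ are isoclinic if there are isomorphisms $\theta:G/Z(G)\to H/Z(H)$ and $\phi:G'\to H'$ (derived subgroups) such that $\phi([g_1,g_2])=[h_1,h_2]$ whenever $\theta(g_iZ(G))=h_iZ(H)$ for $i=1,2$. Isoclinism is an equivalence relation, whose classes are called isoclinism families. For a $p$-group $G$, the rank of (the family of) $G$ is the smallest $r$ such that the isoclinism family of $G$ contains a group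 of order $p^r$. $\Phi_9$ (James's notation) is the isoclinism family, of rank 5, of the group of order $p^5$ $$\Phi_9(1^5)=\langle \alpha, \alpha_1,\alpha_2,\alpha_3, \alpha_4\mid[\alpha_i,\alpha]=\alpha_{i+1},\ \alpha^p=\alpha_1^{(p)}=\alpha_{i+1}^{(p)}=1\ (i=1,2,3) \rangle ,$$ where $\alpha_{i+1}^{(p)}$ denotes $\alpha_{i+1}^p\alpha_{i+2}^{\binom p2}\cdots \alpha_{i+p}^{\binom pp}$ for $i\ge 0$, with $\alpha_j=1$ for $j>4$. Here $[x,y]=x^{-1}y^{-1}xy$, and by convention all pairs of generators whose commutator is not listed commute. $G$ belongs to $\Phi_9$ if $G$ is a finite $p$-group isoclinic to this group. *)

theory Defs
  imports
    "HOL-Algebra.Group_Action"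
    "HOL-Algebra.Generated_Groups"
    "HOL-Computational_Algebra.Formal_Power_Series"
begin

section \<open>Orbits of simultaneous conjugation\<close>

text \<open>The set $G^n$; tuples are lists.\<close>

definition tuples :: "('a, 'b) monoid_scheme \<Rightarrow> nat \<Rightarrow> 'a list set" where
  "tuples G n = {xs. length xs = n \<and> set xs \<subseteq> carrier G}"

text \<open>The set $G^{(n)}$.\<close>

definition commuting_tuples :: "('a, 'b) monoid_scheme \<Rightarrow> nat \<Rightarrow> 'a list set" where
  "commuting_tuples G n =
    {xs \<in> tuples G n. \<forall>i<n. \<forall>j<n. xs ! i \<otimes>\<^bsub>G\<^esub> xs ! j = xs ! j \<otimes>\<^bsub>G\<^esub> xs ! i}"

text \<open>The restriction to \<open>E\<close> is required by the locale \<^locale>\<open>group_action\<close>, where a group acts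
  through extensional bijections of \<open>E\<close>.\<close>

definition sim_conj :: "('a, 'b) monoid_scheme \<Rightarrow> 'a list set \<Rightarrow> 'a \<Rightarrow> 'a list \<Rightarrow> 'a list" where
  "sim_conj G E g = (\<lambda>xs\<in>E. map (\<lambda>x. g \<otimes>\<^bsub>G\<^esub> x \<otimes>\<^bsub>G\<^esub> inv\<^bsub>G\<^esub> g) xs)"

definition alpha :: "('a, 'b) monoid_scheme \<Rightarrow> nat \<Rightarrow> nat" where
  "alpha G n = card (orbits G (tuples G n) (sim_conj G (tuples G n)))"

definition beta :: "('a, 'b) monoid_scheme \<Rightarrow> nat \<Rightarrow> nat" where
  "beta G n = card (orbits G (commuting_tuples G n) (sim_conj G (commuting_tuples G n)))"

definition A_series :: "('a, 'b) monoid_scheme \<Rightarrow> rat fps" where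
  "A_series G = Abs_fps (\<lambda>n. of_nat (alpha G n))"

definition B_series :: "('a, 'b) monoid_scheme \<Rightarrow> rat fps" where
  "B_series G = Abs_fps (\<lambda>n. of_nat (beta G n))"

lemma (in group) sim_conj_action:
  assumes sub: "E \<subseteq> {xs. set xs \<subseteq> carrier G}"
    and stable: "\<And>g xs. g \<in> carrier G \<Longrightarrow> xs \<in> E \<Longrightarrow> map (\<lambda>x. g \<otimes> x \<otimes> inv g) xs \<in> E"
  shows "group_action G E (sim_conj G E)"
proof -
  have elem: "x \<in> carrier G" if "xs \<in> E" "x \<in> set xs" for x xs
    using that sub by blast
  have one: "map (\<lambda>x. \<one> \<otimes> x \<otimes> inv \<one>) xs = xs" if "xs \<in> E" for xs
    by (rule map_idI) (simp add: elem[OF that])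
  have comp: "map (\<lambda>x. g \<otimes> x \<otimes> inv g) (map (\<lambda>x. h \<otimes> x \<otimes> inv h) xs)
      = map (\<lambda>x. (g \<otimes> h) \<otimes> x \<otimes> inv (g \<otimes> h)) xs"
    if "xs \<in> E" "g \<in> carrier G" "h \<in> carrier G" for xs g h
    using that(2,3) by (simp add: elem[OF that(1)] m_assoc inv_mult_group)
  have eval: "sim_conj G E g xs = map (\<lambda>x. g \<otimes> x \<otimes> inv g) xs" if "xs \<in> E" for g xs
    using that by (simp add: sim_conj_def)
  have mem: "sim_conj G E g xs \<in> E" if "g \<in> carrier G" "xs \<in> E" for g xs
    unfolding eval[OF that(2)] by (rule stable[OF that])
  have mult: "sim_conj G E g (sim_conj G E h xs) = sim_conj G E (g \<otimes> h) xs"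
    if "g \<in> carrier G" "h \<in> carrier G" "xs \<in> E" for g h xs
    using comp[OF that(3,1,2)] eval[OF mem[OF that(2,3)], of g]
    by (simp only: eval[OF that(3)])
  have unit: "sim_conj G E \<one> xs = xs" if "xs \<in> E" for xs
    unfolding eval[OF that] by (rule one[OF that])
  have bij: "bij_betw (sim_conj G E g) E E" if g: "g \<in> carrier G" for g
  proof (rule bij_betw_byWitness[where f' = "sim_conj G E (inv g)"])
    show "\<forall>a\<in>E. sim_conj G E (inv g) (sim_conj G E g a) = a"
      using g by (simp add: mult unit)
    show "\<forall>a\<in>E. sim_conj G E g (sim_conj G E (inv g) a) = a"
      using g by (simp add: mult unit)
  qed (use mem g in auto)
  have Bij: "sim_conj G E g \<in> Bij E" if "g \<in> carrier G" for g
    using bij[OF that] by (simp add: Bij_def) (simp add: sim_conj_def)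
  have "sim_conj G E \<in> hom G (BijGroup E)"
  proof (rule homI)
    fix g assume "g \<in> carrier G"
    then show "sim_conj G E g \<in> carrier (BijGroup E)"
      using Bij by (simp add: BijGroup_def)
  next
    fix g h assume gh: "g \<in> carrier G" "h \<in> carrier G"
    have "sim_conj G E (g \<otimes> h) xs = compose E (sim_conj G E g) (sim_conj G E h) xs" for xs
    proof (cases "xs \<in> E")
      case True
      then show ?thesis by (simp add: compose_def mult[OF gh])
    next
      case False
      then show ?thesis by (simp add: compose_def sim_conj_def)
    qed
    then have "sim_conj G E (g \<otimes> h) = compose E (sim_conj G E g) (sim_conj G E h)"
      by (rule ext)
    then show "sim_conj G E (g \<otimes> h)
        = sim_conj G E g \<otimes>\<^bsub>BijGroup E\<^esub> sim_conj G E h"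
      using Bij[OF gh(1)] Bij[OF gh(2)] by (simp add: BijGroup_def)
  qed
  then show ?thesis
    by (simp add: group_action_def group_hom_def group_hom_axioms_def group_BijGroup)
qed


section \<open>Isoclinism\<close>

definition center :: "('a, 'b) monoid_scheme \<Rightarrow> 'a set" where
  "center G = {z \<in> carrier G. \<forall>x\<in>carrier G. z \<otimes>\<^bsub>G\<^esub> x = x \<otimes>\<^bsub>G\<^esub> z}"

definition commutator :: "('a, 'b) monoid_scheme \<Rightarrow> 'a \<Rightarrow> 'a \<Rightarrow> 'a" where
  "commutator G x y = inv\<^bsub>G\<^esub> x \<otimes>\<^bsub>G\<^esub> inv\<^bsub>G\<^esub> y \<otimes>\<^bsub>G\<^esub> x \<otimes>\<^bsub>G\<^esub> y"

text \<open>The library generates \<^const>\<open>derived\<close> from the elements $xyx^{-1}y^{-1}$; as $x$, $y$ range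
  over the whole group these are the same elements as the commutators above.\<close>

definition derived_group :: "('a, 'b) monoid_scheme \<Rightarrow> ('a, 'b) monoid_scheme" where
  "derived_group G = G\<lparr>carrier := derived G (carrier G)\<rparr>"

text \<open>\<^const>\<open>FactGroup\<close> is formed from right cosets, which agree with the left ones for the center.\<close>

definition isoclinic :: "('a, 'b) monoid_scheme \<Rightarrow> ('c, 'd) monoid_scheme \<Rightarrow> bool" where
  "isoclinic G H \<longleftrightarrow>
    (\<exists>\<theta> \<phi>. \<theta> \<in> iso (G Mod center G) (H Mod center H) \<and>
           \<phi> \<in> iso (derived_group G) (derived_group H) \<and>
           (\<forall>g1 \<in> carrier G. \<forall>g2 \<in> carrier G. \<forall>h1 \<in> carrier H. \<forall>h2 \<in> carrier H.
              \<theta> (center G #>\<^bsub>G\<^esub> g1) = center H #>\<^bsub>H\<^esub> h1 \<longrightarrow>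
              \<theta> (center G #>\<^bsub>G\<^esub> g2) = center H #>\<^bsub>H\<^esub> h2 \<longrightarrow>
              \<phi> (commutator G g1 g2) = commutator H h1 h2))"

text \<open>Every finite group is isomorphic to one whose elements are natural numbers, so it suffices
  to let \<open>H\<close> range over these.\<close>

definition family_rank :: "nat \<Rightarrow> ('a, 'b) monoid_scheme \<Rightarrow> nat" where
  "family_rank p G =
    (LEAST r. \<exists>H :: nat monoid. group H \<and> order H = p ^ r \<and> isoclinic G H)"


section \<open>Groups given by generators and relations\<close>

text \<open>A word is a list of letters $x$ (encoded \<open>(x, False)\<close>) and $x^{-1}$ (encoded \<open>(x, True)\<close>).
  A pair \<open>(r, s)\<close> of words stands for the relation $r = s$.\<close>

type_synonym 'g word = "('g \<times> bool) list"

definition word_inv :: "'g word \<Rightarrow> 'g word" where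
  "word_inv w = rev (map (\<lambda>(x, b). (x, \<not> b)) w)"

definition word_pow :: "'g word \<Rightarrow> nat \<Rightarrow> 'g word" where
  "word_pow w n = concat (replicate n w)"

definition word_comm :: "'g word \<Rightarrow> 'g word \<Rightarrow> 'g word" where
  "word_comm u v = word_inv u @ word_inv v @ u @ v"

text \<open>Equality of words in the presented group: the congruence on words generated by free
  cancellation and the given relations.\<close>

inductive_set pres_rel :: "('g word \<times> 'g word) set \<Rightarrow> ('g word \<times> 'g word) set"
  for R :: "('g word \<times> 'g word) set"
where
  refl: "(u, u) \<in> pres_rel R"
| sym: "(u, v) \<in> pres_rel R \<Longrightarrow> (v, u) \<in> pres_rel R"
| trans: "(u, v) \<in> pres_rel R \<Longrightarrow> (v, w) \<in> pres_rel R \<Longrightarrow> (u, w) \<in> pres_rel R"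
| cancel: "(u @ [(x, b), (x, \<not> b)] @ v, u @ v) \<in> pres_rel R"
| relation: "(r, s) \<in> R \<Longrightarrow> (u @ r @ v, u @ s @ v) \<in> pres_rel R"

text \<open>The generators are all elements of the type \<open>'g\<close>.\<close>

definition presented_group :: "('g word \<times> 'g word) set \<Rightarrow> 'g word set monoid" where
  "presented_group R =
    \<lparr>carrier = UNIV // pres_rel R,
     monoid.mult = (\<lambda>A B. \<Union>a\<in>A. \<Union>b\<in>B. pres_rel R `` {a @ b}),
     one = pres_rel R `` {[]}\<rparr>"

lemma equiv_pres_rel: "equiv UNIV (pres_rel R)"
  by (intro equivI refl_onI symI transI) (auto intro: pres_rel.intros)

lemma pres_rel_context:
  "(u, v) \<in> pres_rel R \<Longrightarrow> (a @ u @ c, a @ v @ c) \<in> pres_rel R"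
proof (induction rule: pres_rel.induct)
  case (cancel u x b v)
  show ?case using pres_rel.cancel[of "a @ u" x b "v @ c" R] by simp
next
  case (relation r s u v)
  then show ?case using pres_rel.relation[of r s R "a @ u" "v @ c"] by simp
qed (auto intro: pres_rel.refl pres_rel.sym pres_rel.trans)

lemma pres_rel_append:
  assumes "(u, u') \<in> pres_rel R" "(v, v') \<in> pres_rel R"
  shows "(u @ v, u' @ v') \<in> pres_rel R"
proof (rule pres_rel.trans)
  show "(u @ v, u' @ v) \<in> pres_rel R"
    using pres_rel_context[OF assms(1), of "[]" v] by simp
  show "(u' @ v, u' @ v') \<in> pres_rel R"
    using pres_rel_context[OF assms(2), of u' "[]"] by simp
qed

lemma pres_rel_word_inv: "(word_inv w @ w, []) \<in> pres_rel R"
proof (induction w)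
  case Nil
  show ?case by (simp add: word_inv_def pres_rel.refl)
next
  case (Cons l w)
  obtain x b where l: "l = (x, b)" by fastforce
  have "(word_inv (l # w) @ (l # w), word_inv w @ w) \<in> pres_rel R"
    using pres_rel.cancel[of "word_inv w" x "\<not> b" w R] by (simp add: l word_inv_def)
  then show ?case using Cons by (rule pres_rel.trans)
qed

lemma presented_group_mult:
  "(pres_rel R `` {u}) \<otimes>\<^bsub>presented_group R\<^esub> (pres_rel R `` {v}) = pres_rel R `` {u @ v}"
proof -
  have "(\<lambda>a b. pres_rel R `` {a @ b}) respects2 pres_rel R"
    by (intro congruent2I' equiv_class_eq[OF equiv_pres_rel] pres_rel_append)
  then show ?thesis
    unfolding presented_group_def monoid.simps
    by (rule UN_equiv_class2[OF equiv_pres_rel equiv_pres_rel]) simp_all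
qed

lemma group_presented_group: "group (presented_group R)"
proof -
  let ?P = "presented_group R" and ?c = "\<lambda>w. pres_rel R `` {w}"
  have one: "\<one>\<^bsub>?P\<^esub> = ?c []" by (simp add: presented_group_def)
  have memI: "?c w \<in> carrier ?P" for w
    by (simp add: presented_group_def quotientI)
  have memE: "\<exists>w. A = ?c w" if "A \<in> carrier ?P" for A
    using that by (auto simp: presented_group_def quotient_def)
  show ?thesis
  proof (rule groupI)
    show "\<one>\<^bsub>?P\<^esub> \<in> carrier ?P" by (simp add: one memI)
    show "A \<otimes>\<^bsub>?P\<^esub> B \<in> carrier ?P" if "A \<in> carrier ?P" "B \<in> carrier ?P" for A B
      using memE[OF that(1)] memE[OF that(2)] by (auto simp: presented_group_mult memI)
    show "A \<otimes>\<^bsub>?P\<^esub> B \<otimes>\<^bsub>?P\<^esub> C = A \<otimes>\<^bsub>?P\<^esub> (B \<otimes>\<^bsub>?P\<^esub> C)"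
      if "A \<in> carrier ?P" "B \<in> carrier ?P" "C \<in> carrier ?P" for A B C
      using memE[OF that(1)] memE[OF that(2)] memE[OF that(3)]
      by (auto simp: presented_group_mult)
    show "\<one>\<^bsub>?P\<^esub> \<otimes>\<^bsub>?P\<^esub> A = A" if "A \<in> carrier ?P" for A
      using memE[OF that] by (auto simp: one presented_group_mult)
    show "\<exists>B\<in>carrier ?P. B \<otimes>\<^bsub>?P\<^esub> A = \<one>\<^bsub>?P\<^esub>" if A: "A \<in> carrier ?P" for A
    proof -
      obtain w where w: "A = ?c w" using memE[OF A] by blast
      have "?c (word_inv w) \<otimes>\<^bsub>?P\<^esub> A = \<one>\<^bsub>?P\<^esub>"
        unfolding w presented_group_mult one
        by (rule equiv_class_eq[OF equiv_pres_rel pres_rel_word_inv])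
      then show ?thesis using memI by blast
    qed
  qed
qed


section \<open>The isoclinism family \<open>\<Phi>\<^sub>9\<close>\<close>

datatype phi9_gen = Gen_a | Gen_a1 | Gen_a2 | Gen_a3 | Gen_a4

definition a_word :: "phi9_gen word" where
  "a_word = [(Gen_a, False)]"

text \<open>The word for $\alpha_j$ with $j \ge 1$, where $\alpha_j = 1$ for $j > 4$.
  The index $0$ is not used.\<close>

definition ai_word :: "nat \<Rightarrow> phi9_gen word" where
  "ai_word j =
    (if j = 1 then [(Gen_a1, False)]
     else if j = 2 then [(Gen_a2, False)]
     else if j = 3 then [(Gen_a3, False)]
     else if j = 4 then [(Gen_a4, False)]
     else [])"

text \<open>The word $\alpha_j^{(p)} = \alpha_j^{\binom p1} \alpha_{j+1}^{\binom p2} \cdots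
  \alpha_{j+p-1}^{\binom pp}$.\<close>

definition ai_paren_word :: "nat \<Rightarrow> nat \<Rightarrow> phi9_gen word" where
  "ai_paren_word p j =
    concat (map (\<lambda>k. word_pow (ai_word (j + k)) (p choose (k + 1))) [0..<p])"

text \<open>The second and third sets are the relations left implicit in the presentation: pairs of generators
  whose commutator is not listed commute.\<close>

definition phi9_relations :: "nat \<Rightarrow> (phi9_gen word \<times> phi9_gen word) set" where
  "phi9_relations p =
    {(word_comm (ai_word i) a_word, ai_word (i + 1)) | i. i \<in> {1, 2, 3}} \<union>
    {(word_comm (ai_word 4) a_word, [])} \<union>
    {(word_comm (ai_word i) (ai_word j), []) | i j. i \<in> {1..4} \<and> j \<in> {1..4}} \<union>
    {(word_pow a_word p, [])} \<union>
    {(ai_paren_word p 1, [])} \<union>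
    {(ai_paren_word p (i + 1), []) | i. i \<in> {1, 2, 3}}"

text \<open>The group $\Phi_9(1^5)$ for the prime \<open>p\<close>.\<close>

definition phi9_group :: "nat \<Rightarrow> phi9_gen word set monoid" where
  "phi9_group p = presented_group (phi9_relations p)"

definition in_phi9 :: "nat \<Rightarrow> ('a, 'b) monoid_scheme \<Rightarrow> bool" where
  "in_phi9 p G \<longleftrightarrow> group G \<and> (\<exists>m. order G = p ^ m) \<and> isoclinic G (phi9_group p)"

end

theory Submission
  imports Defs "HOL-Number_Theory.Cong"
begin

text \<open>Both generating functions count commuting patterns: by Burnside, \<open>\<alpha>\<^sub>n |G|\<close> is the sum of
  \<open>|C(g)|\<^sup>n\<close> over \<open>g\<close>, and \<open>\<beta>\<^sub>n |G|\<close> is the number of commuting \<open>(n + 1)\<close>-tuples. If \<open>G\<close> is a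
  nonabelian \<open>p\<close>-group with an abelian subgroup \<open>A\<close> of index \<open>p\<close> and center \<open>Z\<close>, then \<open>C(g) = A\<close> for
  \<open>g \<in> A - Z\<close>, while \<open>C(g)\<close> is abelian of order \<open>p |Z|\<close> for \<open>g \<notin> A\<close>; so \<open>|G : Z|\<close> determines both
  numbers up to the scaling by \<open>|G|\<close>. The index of \<open>Z\<close> and the existence of \<open>A\<close> are invariant under
  isoclinism, and \<open>\<Phi>\<^sub>9(1\<^sup>5)\<close> has such an \<open>A\<close>, generated by the \<open>\<alpha>\<^sub>i\<close>, with \<open>|G : Z| = p\<^sup>4\<close>. The
  presentation bounds the order of that group by \<open>p\<^sup>5\<close>; that it does not collapse follows as soon as
  \<open>\<alpha>\<^sub>4 \<noteq> 1\<close>, which is seen in an explicit action.\<close>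

section \<open>Centralizers and the center\<close>

definition centralizer :: "('a, 'b) monoid_scheme \<Rightarrow> 'a \<Rightarrow> 'a set" where
  "centralizer G g = {x \<in> carrier G. g \<otimes>\<^bsub>G\<^esub> x = x \<otimes>\<^bsub>G\<^esub> g}"

context group
begin

lemma centralizer_subset: "centralizer G g \<subseteq> carrier G"
  by (auto simp: centralizer_def)

lemma mem_centralizer_commute:
  assumes "g \<in> carrier G" "x \<in> carrier G"
  shows "x \<in> centralizer G g \<longleftrightarrow> g \<in> centralizer G x"
  using assms by (auto simp: centralizer_def)

lemma centralizer_self: "g \<in> carrier G \<Longrightarrow> g \<in> centralizer G g"
  by (simp add: centralizer_def)

lemma subgroup_centralizer:
  assumes g: "g \<in> carrier G"
  shows "subgroup (centralizer G g) G"
proof (rule subgroupI)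
  show "centralizer G g \<subseteq> carrier G" by (rule centralizer_subset)
  show "centralizer G g \<noteq> {}" using centralizer_self[OF g] by blast
  show "inv x \<in> centralizer G g" if "x \<in> centralizer G g" for x
  proof -
    have x: "x \<in> carrier G" "g \<otimes> x = x \<otimes> g" using that by (auto simp: centralizer_def)
    have "g \<otimes> inv x = inv x \<otimes> (x \<otimes> g) \<otimes> inv x"
      using x(1) g by (simp add: m_assoc[symmetric])
    also have "\<dots> = inv x \<otimes> g"
      unfolding x(2)[symmetric] using x(1) g by (simp add: m_assoc)
    finally show ?thesis using x by (simp add: centralizer_def)
  qed
  show "x \<otimes> y \<in> centralizer G g" if "x \<in> centralizer G g" "y \<in> centralizer G g" for x y
  proof -
    have x: "x \<in> carrier G" "g \<otimes> x = x \<otimes> g" and y: "y \<in> carrier G" "g \<otimes> y = y \<otimes> g"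
      using that by (auto simp: centralizer_def)
    have "g \<otimes> (x \<otimes> y) = x \<otimes> (g \<otimes> y)" using x y(1) g by (simp add: m_assoc[symmetric])
    also have "\<dots> = x \<otimes> y \<otimes> g" using x(1) y g by (simp add: m_assoc)
    finally show ?thesis using x y by (simp add: centralizer_def)
  qed
qed

lemma center_eq_Inter: "center G = carrier G \<inter> (\<Inter>x\<in>carrier G. centralizer G x)"
  by (auto simp: center_def centralizer_def)

lemma center_subset: "center G \<subseteq> carrier G"
  by (auto simp: center_def)

lemma center_subset_centralizer: "x \<in> carrier G \<Longrightarrow> center G \<subseteq> centralizer G x"
  by (auto simp: center_eq_Inter)

lemma center_iff_centralizer:
  "g \<in> carrier G \<Longrightarrow> g \<in> center G \<longleftrightarrow> centralizer G g = carrier G"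
  by (auto simp: center_def centralizer_def)

lemma subgroup_center: "subgroup (center G) G"
proof -
  have "center G = (\<Inter>x\<in>carrier G. centralizer G x)"
    using centralizer_subset one_closed by (fastforce simp: center_eq_Inter)
  moreover have "subgroup (\<Inter> (centralizer G ` carrier G)) G"
    using subgroup_centralizer by (intro subgroups_Inter) auto
  ultimately show ?thesis by simp
qed

lemma normal_center: "center G \<lhd> G"
proof (rule normal_invI[OF subgroup_center])
  fix x h assume "x \<in> carrier G" "h \<in> center G"
  then have "h \<in> carrier G" "x \<otimes> h = h \<otimes> x" "x \<in> carrier G" "h \<in> center G"
    by (auto simp: center_def)
  then show "x \<otimes> h \<otimes> inv x \<in> center G"
    by (simp add: m_assoc)
qed

lemma inv_mult_eq_one_iff:
  assumes "x \<in> carrier G" "y \<in> carrier G"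
  shows "inv x \<otimes> y = \<one> \<longleftrightarrow> x = y"
proof
  assume "inv x \<otimes> y = \<one>"
  then have "x \<otimes> (inv x \<otimes> y) = x" using assms by simp
  then show "x = y" using assms by (simp add: m_assoc[symmetric])
qed (use assms in simp)

lemma commutator_eq:
  assumes "x \<in> carrier G" "y \<in> carrier G"
  shows "commutator G x y = inv (y \<otimes> x) \<otimes> (x \<otimes> y)"
  using assms by (simp add: commutator_def m_assoc inv_mult_group)

lemma commutator_eq_one_iff:
  assumes "x \<in> carrier G" "y \<in> carrier G"
  shows "commutator G x y = \<one> \<longleftrightarrow> x \<otimes> y = y \<otimes> x"
  using assms by (auto simp: commutator_eq inv_mult_eq_one_iff)

lemma card_subgroup_dvd:
  assumes K: "subgroup K G" and L: "subgroup L G" and KL: "K \<subseteq> L"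
  shows "card K dvd card L"
proof -
  interpret L: group "G\<lparr>carrier := L\<rparr>" using subgroup_imp_group[OF L] .
  have "subgroup K (G\<lparr>carrier := L\<rparr>)" using subgroup_incl[OF K L KL] .
  then have "card (rcosets\<^bsub>G\<lparr>carrier := L\<rparr>\<^esub> K) * card K = card L"
    using L.lagrange by (simp add: order_def)
  then show ?thesis by (metis dvd_triv_right)
qed

text \<open>By Lagrange, \<open>|L| / |K|\<close> divides the prime \<open>p\<close>, and it is not
  1 because \<open>K \<noteq> L\<close>. This is applied to \<open>A\<close> in the whole group and
  to the center in the centralizer of an element outside \<open>A\<close>.\<close>

lemma subgroup_prime_index_maximal:
  assumes K: "subgroup K G" and L: "subgroup L G" and M: "subgroup M G"
    and KL: "K \<subseteq> L" and LM: "L \<subseteq> M" and neq: "K \<noteq> L" and fin: "finite M"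
    and p: "prime p" and card: "card M = p * card K"
  shows "L = M"
proof -
  have finL: "finite L" using LM fin finite_subset by blast
  then have "finite K" using KL finite_subset by blast
  moreover have "K \<noteq> {}" using K subgroup.one_closed by blast
  ultimately have K0: "card K > 0" by (simp add: card_gt_0_iff)
  obtain k where k: "card L = card K * k" using card_subgroup_dvd[OF K L KL] by (auto elim: dvdE)
  have "k dvd p"
    using card_subgroup_dvd[OF L M LM] K0 unfolding card k by (simp add: mult.commute)
  then have "k = 1 \<or> k = p" using p by (auto simp: prime_nat_iff)
  moreover have "k \<noteq> 1"
    using card_subset_eq[OF finL KL] k neq by auto
  ultimately have "card L = card M" using k card by simp
  then show ?thesis using card_subset_eq[OF fin LM] by simp
qed

end

section \<open>Groups with an abelian subgroup of prime index\<close>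

locale abelian_maximal = group G for G :: "('a, 'b) monoid_scheme" (structure) +
  fixes p m :: nat and A :: "'a set"
  assumes p: "prime p"
    and order: "order G = p ^ m"
    and A: "subgroup A G"
    and abelian: "\<And>x y. x \<in> A \<Longrightarrow> y \<in> A \<Longrightarrow> x \<otimes> y = y \<otimes> x"
    and index: "order G = p * card A"
    and nonabelian: "center G \<noteq> carrier G"
begin

lemma finite_carrier: "finite (carrier G)"
  using order p prime_gt_0_nat[OF p] card_ge_0_finite[of "carrier G"] by (simp add: order_def)

lemma A_subset: "A \<subseteq> carrier G"
  using A by (rule subgroup.subset)

lemma finite_A: "finite A" and finite_center: "finite (center G)"
  using finite_carrier A_subset center_subset finite_subset by blast+

lemma maximal:
  assumes "subgroup L G" "A \<subseteq> L" "x \<in> L" "x \<notin> A"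
  shows "L = carrier G"
  using assms p index finite_carrier subgroup.subset[OF assms(1)]
  by (intro subgroup_prime_index_maximal[OF A assms(1) subgroup_self]) (auto simp: order_def)

lemma A_subset_centralizer: "x \<in> A \<Longrightarrow> A \<subseteq> centralizer G x"
  using A_subset abelian by (auto simp: centralizer_def)

text \<open>The centralizer of any \<open>y \<in> A\<close> contains \<open>A\<close>. With a
  central element outside \<open>A\<close> it would be all of \<open>G\<close>; then
  \<open>A\<close> itself would be central, and the center, being larger than \<open>A\<close>,
  would be \<open>G\<close>.\<close>

lemma center_subset_A: "center G \<subseteq> A"
proof
  fix z assume z: "z \<in> center G"
  show "z \<in> A"
  proof (rule ccontr)
    assume zA: "z \<notin> A"
    have "centralizer G y = carrier G" if "y \<in> A" for y
    proof (rule maximal[OF subgroup_centralizer A_subset_centralizer])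
      show "z \<in> centralizer G y" using center_subset_centralizer z that A_subset by blast
    qed (use that A_subset zA in auto)
    then have "A \<subseteq> center G" using A_subset center_iff_centralizer by blast
    then have "center G = carrier G" using maximal[OF subgroup_center _ z zA] by blast
    then show False using nonabelian by contradiction
  qed
qed

lemma centralizer_in_A:
  assumes "g \<in> A" "g \<notin> center G"
  shows "centralizer G g = A"
proof -
  have g: "g \<in> carrier G" using assms A_subset by blast
  have "centralizer G g \<noteq> carrier G" using assms g center_iff_centralizer by blast
  then show ?thesis
    using maximal[OF subgroup_centralizer[OF g] A_subset_centralizer[OF assms(1)]]
      A_subset_centralizer[OF assms(1)] by blast
qed

text \<open>An element of \<open>A\<close> commuting with \<open>g\<close> is centralized by
  \<open>A\<close> and by \<open>g\<close>, hence by \<open>G\<close>, since \<open>A\<close> is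
  maximal.\<close>

lemma centralizer_Int_A:
  assumes g: "g \<in> carrier G" "g \<notin> A"
  shows "centralizer G g \<inter> A = center G"
proof
  show "center G \<subseteq> centralizer G g \<inter> A"
    using center_subset_A center_subset_centralizer g by blast
  show "centralizer G g \<inter> A \<subseteq> center G"
  proof
    fix y assume y: "y \<in> centralizer G g \<inter> A"
    then have yc: "y \<in> carrier G" using A_subset by blast
    have "g \<in> centralizer G y" using y yc g mem_centralizer_commute by blast
    then have "centralizer G y = carrier G"
      using maximal[OF subgroup_centralizer[OF yc]] A_subset_centralizer y g(2) by blast
    then show "y \<in> center G" using yc center_iff_centralizer by blast
  qed
qed

lemma card_center_pos: "card (center G) > 0"
  using finite_center subgroup.one_closed[OF subgroup_center] by (auto simp: card_gt_0_iff)

text \<open>Upper bound: each of the \<open>p\<close> cosets of \<open>A\<close> meets the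
  centralizer in at most a translate of its intersection with \<open>A\<close>, which is the center.
  Lower bound: the center has index a power of \<open>p\<close> in the centralizer, and
  \<open>g\<close> shows that the index is not 1.\<close>

lemma card_centralizer_notin_A:
  assumes g: "g \<in> carrier G" "g \<notin> A"
  shows "card (centralizer G g) = p * card (center G)"
proof -
  let ?C = "centralizer G g"
  have C: "subgroup ?C G" using subgroup_centralizer[OF g(1)] .
  have finC: "finite ?C" using finite_carrier centralizer_subset finite_subset by blast
  have le: "card ?C \<le> p * card (center G)"
  proof -
    have part: "?C = (\<Union>X\<in>rcosets A. ?C \<inter> X)"
      using rcosets_part_G[OF A] centralizer_subset by blast
    have "card (?C \<inter> X) \<le> card (center G)" if X: "X \<in> rcosets A" for X
    proof (cases "?C \<inter> X = {}")
      case False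
      then obtain y where y: "y \<in> ?C" "y \<in> X" by blast
      have yc: "y \<in> carrier G" using y centralizer_subset by blast
      have XA: "X = A #> y"
        using X y(2) A yc repr_independence by (auto simp: RCOSETS_def)
      \<comment> \<open>Dividing by a fixed common element \<open>y\<close> moves the intersection
        with the coset into the intersection with \<open>A\<close>.\<close>
      have "(\<lambda>x. x \<otimes> inv y) ` (?C \<inter> X) \<subseteq> ?C \<inter> A"
      proof (intro subsetI, elim imageE)
        fix w x assume w: "w = x \<otimes> inv y" and x: "x \<in> ?C \<inter> X"
        have "w \<in> ?C" unfolding w
          using C x y by (auto intro!: subgroup.m_closed subgroup.m_inv_closed)
        moreover obtain k where "k \<in> A" "x = k \<otimes> y" using x XA by (auto simp: r_coset_def)
        then have "w \<in> A" using w yc A_subset by (auto simp: m_assoc)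
        ultimately show "w \<in> ?C \<inter> A" by simp
      qed
      moreover have "inj_on (\<lambda>x. x \<otimes> inv y) (?C \<inter> X)"
      proof (rule inj_onI)
        fix u v assume uv: "u \<in> ?C \<inter> X" "v \<in> ?C \<inter> X" "u \<otimes> inv y = v \<otimes> inv y"
        then have "u \<in> carrier G" "v \<in> carrier G" using centralizer_subset by blast+
        then show "u = v" using uv(3) yc by simp
      qed
      ultimately show ?thesis
        unfolding centralizer_Int_A[OF g] using card_inj_on_le finite_center by blast
    qed simp
    then have "card ?C \<le> (\<Sum>X\<in>rcosets A. card (center G))"
      by (subst part) (intro order_trans[OF card_UN_le] sum_mono,
        auto simp: RCOSETS_def finite_carrier)
    moreover have "card (rcosets A) = p"
      using lagrange[OF A] index finite_A subgroup.one_closed[OF A] by (auto simp: card_gt_0_iff)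
    ultimately show ?thesis by simp
  qed
  have "card (center G) dvd card ?C"
    using card_subgroup_dvd[OF subgroup_center C] center_subset_centralizer[OF g(1)] .
  then obtain k where k: "card ?C = card (center G) * k" by (auto elim: dvdE)
  have "card ?C dvd p ^ m"
    using card_subgroup_dvd[OF C subgroup_self] centralizer_subset order by (simp add: order_def)
  then have "k dvd p ^ m" unfolding k by (rule dvd_mult_right)
  then obtain i where i: "k = p ^ i" using divides_primepow_nat[OF p] by blast
  have "g \<notin> center G" using g center_subset_A by blast
  then have "k \<noteq> 1"
    using card_subset_eq[OF finC center_subset_centralizer[OF g(1)]] centralizer_self[OF g(1)] k
    by auto
  then have "i > 0" using i by (cases i) auto
  then have "p \<le> k" using i prime_ge_1_nat[OF p] by (cases i) auto
  then show ?thesis using le k card_center_pos by (auto simp: mult.commute le_antisym)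
qed

text \<open>For \<open>g \<notin> A\<close> the center has prime index in the centralizer of
  \<open>g\<close>. If \<open>x\<close> in that centralizer is noncentral, its own centralizer there
  properly contains the center, so it is everything.\<close>

lemma centralizer_abelian:
  assumes g: "g \<in> carrier G" "g \<notin> center G"
    and x: "x \<in> centralizer G g" and y: "y \<in> centralizer G g"
  shows "x \<otimes> y = y \<otimes> x"
proof (cases "g \<in> A")
  case True
  then show ?thesis using abelian centralizer_in_A g x y by blast
next
  case False
  have xc: "x \<in> carrier G" and yc: "y \<in> carrier G" using x y centralizer_subset by blast+
  show ?thesis
  proof (cases "x \<in> A")
    case True
    then have "x \<in> center G" using centralizer_Int_A[OF g(1) False] x by blast
    then show ?thesis using yc by (simp add: center_def)
  next
    case xA: False
    have "centralizer G x \<inter> centralizer G g = centralizer G g"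
    proof (rule subgroup_prime_index_maximal[OF subgroup_center _ _ _ _ _ _ p])
      show "subgroup (centralizer G x \<inter> centralizer G g) G"
        using subgroups_Inter_pair subgroup_centralizer xc g(1) by blast
      show "center G \<subseteq> centralizer G x \<inter> centralizer G g"
        using center_subset_centralizer xc g(1) by blast
      show "center G \<noteq> centralizer G x \<inter> centralizer G g"
        using x xA center_subset_A centralizer_self[OF xc] by blast
      show "card (centralizer G g) = p * card (center G)"
        by (rule card_centralizer_notin_A[OF g(1) False])
    qed (use subgroup_centralizer g(1) finite_carrier centralizer_subset finite_subset in blast)+
    then show ?thesis using y by (auto simp: centralizer_def)
  qed
qed

text \<open>The group splits into the center, the rest of \<open>A\<close> and the complement of
  \<open>A\<close>; on the first two the centralizer is constant, on the third \<open>f\<close>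
  is.\<close>

lemma sum_over_centralizers:
  fixes f :: "'a set \<Rightarrow> nat"
  assumes "\<And>g. g \<in> carrier G \<Longrightarrow> g \<notin> A \<Longrightarrow> f (centralizer G g) = c"
  shows "(\<Sum>g\<in>carrier G. f (centralizer G g)) =
    card (center G) * f (carrier G) + (card A - card (center G)) * f A
      + (card (carrier G) - card A) * c"
proof -
  let ?F = "\<lambda>g. f (centralizer G g)"
  have "sum ?F (carrier G) = sum ?F A + sum ?F (carrier G - A)"
    using sum.subset_diff[OF A_subset finite_carrier, of ?F] by simp
  also have "sum ?F A = sum ?F (center G) + sum ?F (A - center G)"
    using sum.subset_diff[OF center_subset_A finite_A, of ?F] by simp
  also have "sum ?F (center G) = card (center G) * f (carrier G)"
  proof -
    have "centralizer G g = carrier G" if "g \<in> center G" for g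
      using that center_subset center_iff_centralizer by blast
    then show ?thesis by simp
  qed
  also have "sum ?F (A - center G) = (card A - card (center G)) * f A"
    using centralizer_in_A by (simp add: card_Diff_subset[OF finite_center center_subset_A])
  also have "sum ?F (carrier G - A) = (card (carrier G) - card A) * c"
    using assms by (simp add: card_Diff_subset[OF finite_A A_subset])
  finally show ?thesis .
qed

end

section \<open>Orbits and commuting tuples\<close>

context group
begin

lemma conj_fix_iff:
  assumes "g \<in> carrier G" "set xs \<subseteq> carrier G"
  shows "map (\<lambda>x. g \<otimes> x \<otimes> inv g) xs = xs \<longleftrightarrow> set xs \<subseteq> centralizer G g"
proof -
  have "g \<otimes> x \<otimes> inv g = x \<longleftrightarrow> x \<in> centralizer G g" if "x \<in> set xs" for x
  proof -
    have x: "x \<in> carrier G" using that assms(2) by blast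
    then have "g \<otimes> x \<otimes> inv g = x \<longleftrightarrow> g \<otimes> x = x \<otimes> g"
      using assms(1) by (metis inv_solve_right' m_closed)
    then show ?thesis using x by (simp add: centralizer_def)
  qed
  then have "set xs \<subseteq> centralizer G g \<longleftrightarrow> (\<forall>x\<in>set xs. g \<otimes> x \<otimes> inv g = x)" by blast
  also have "\<dots> \<longleftrightarrow> map (\<lambda>x. g \<otimes> x \<otimes> inv g) xs = map (\<lambda>x. x) xs"
    unfolding map_eq_conv ..
  finally show ?thesis by simp
qed

lemma commuting_tuples_iff:
  "xs \<in> commuting_tuples G n \<longleftrightarrow>
    length xs = n \<and> set xs \<subseteq> carrier G \<and> (\<forall>x\<in>set xs. \<forall>y\<in>set xs. x \<otimes> y = y \<otimes> x)"
  by (auto simp: commuting_tuples_def tuples_def all_set_conv_all_nth)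

text \<open>Burnside's lemma: the tuples fixed by \<open>g\<close> are those with all entries in the
  centralizer of \<open>g\<close>.\<close>

lemma card_orbits_sim_conj:
  assumes fin: "finite (carrier G)" and E: "E \<subseteq> tuples G n"
    and stable: "\<And>g xs. g \<in> carrier G \<Longrightarrow> xs \<in> E \<Longrightarrow> map (\<lambda>x. g \<otimes> x \<otimes> inv g) xs \<in> E"
  shows "card (orbits G E (sim_conj G E)) * order G
    = (\<Sum>g\<in>carrier G. card {xs \<in> E. set xs \<subseteq> centralizer G g})"
proof -
  have E': "E \<subseteq> {xs. set xs \<subseteq> carrier G}" using E by (auto simp: tuples_def)
  interpret group_action G E "sim_conj G E" by (rule sim_conj_action[OF E' stable])
  have "finite (tuples G n)"
    using finite_lists_length_eq[OF fin] by (simp add: tuples_def conj_commute)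
  then have "finite E" using E finite_subset by blast
  moreover have "invariants E (sim_conj G E) g = {xs \<in> E. set xs \<subseteq> centralizer G g}"
    if "g \<in> carrier G" for g
    using conj_fix_iff[OF that] E' by (auto simp: invariants_def sim_conj_def)
  ultimately show ?thesis using burnside[OF fin] by simp
qed

lemma alpha_sum:
  assumes fin: "finite (carrier G)"
  shows "alpha G n * order G = (\<Sum>g\<in>carrier G. card (centralizer G g) ^ n)"
proof -
  have "alpha G n * order G
    = (\<Sum>g\<in>carrier G. card {xs \<in> tuples G n. set xs \<subseteq> centralizer G g})"
    unfolding alpha_def by (rule card_orbits_sim_conj[OF fin subset_refl]) (auto simp: tuples_def)
  moreover have "{xs \<in> tuples G n. set xs \<subseteq> centralizer G g}
      = {xs. set xs \<subseteq> centralizer G g \<and> length xs = n}" for g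
    using centralizer_subset[of g] by (auto simp: tuples_def)
  ultimately show ?thesis
    using finite_subset[OF centralizer_subset fin] by (simp add: card_lists_length_eq)
qed

text \<open>Split off the first entry \<open>g\<close>; the remaining entries form a commuting tuple
  in its centralizer.\<close>

lemma card_commuting_tuples_Suc:
  assumes fin: "finite (carrier G)"
  shows "card (commuting_tuples G (Suc n))
    = (\<Sum>g\<in>carrier G. card {xs \<in> commuting_tuples G n. set xs \<subseteq> centralizer G g})"
proof -
  let ?S = "SIGMA g : carrier G. {xs \<in> commuting_tuples G n. set xs \<subseteq> centralizer G g}"
  have "bij_betw (\<lambda>(g, xs). g # xs) ?S (commuting_tuples G (Suc n))"
  proof (rule bij_betw_imageI)
    show "inj_on (\<lambda>(g, xs). g # xs) ?S" by (auto intro: inj_onI)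
    show "(\<lambda>(g, xs). g # xs) ` ?S = commuting_tuples G (Suc n)"
    proof
      show "(\<lambda>(g, xs). g # xs) ` ?S \<subseteq> commuting_tuples G (Suc n)"
        by (auto simp: commuting_tuples_iff centralizer_def subset_iff)
      show "commuting_tuples G (Suc n) \<subseteq> (\<lambda>(g, xs). g # xs) ` ?S"
      proof
        fix ys assume ys: "ys \<in> commuting_tuples G (Suc n)"
        then obtain g xs where "ys = g # xs" by (cases ys) (auto simp: commuting_tuples_iff)
        then show "ys \<in> (\<lambda>(g, xs). g # xs) ` ?S"
          using ys by (intro image_eqI[of _ _ "(g, xs)"])
            (auto simp: commuting_tuples_iff centralizer_def)
      qed
    qed
  qed
  then have "card (commuting_tuples G (Suc n)) = card ?S" by (simp add: bij_betw_same_card)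
  moreover have "finite (commuting_tuples G n)"
    using finite_lists_length_eq[OF fin]
    by (rule rev_finite_subset) (auto simp: commuting_tuples_iff)
  ultimately show ?thesis using fin by simp
qed

text \<open>Burnside's sum of fixed commuting \<open>n\<close>-tuples is the sum obtained by sorting
  commuting \<open>(n + 1)\<close>-tuples by their first entry.\<close>

lemma beta_commuting_tuples:
  assumes fin: "finite (carrier G)"
  shows "beta G n * order G = card (commuting_tuples G (Suc n))"
  unfolding beta_def card_commuting_tuples_Suc[OF fin]
proof (rule card_orbits_sim_conj[OF fin])
  show "commuting_tuples G n \<subseteq> tuples G n" by (auto simp: commuting_tuples_def)
  fix g xs assume g: "g \<in> carrier G" and xs: "xs \<in> commuting_tuples G n"
  have "(g \<otimes> x \<otimes> inv g) \<otimes> (g \<otimes> y \<otimes> inv g) = g \<otimes> (x \<otimes> y) \<otimes> inv g"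
    if "x \<in> carrier G" "y \<in> carrier G" for x y
  proof -
    have "(g \<otimes> x \<otimes> inv g) \<otimes> (g \<otimes> y \<otimes> inv g) = g \<otimes> x \<otimes> (inv g \<otimes> g) \<otimes> y \<otimes> inv g"
      using g that by (simp only: m_assoc m_closed inv_closed)
    then show ?thesis using g that by (simp add: m_assoc)
  qed
  then show "map (\<lambda>x. g \<otimes> x \<otimes> inv g) xs \<in> commuting_tuples G n"
    using g xs by (auto simp: commuting_tuples_iff subset_iff)
qed

end

section \<open>Orbit and tuple counts in terms of the orders of \<open>A\<close> and the
  center\<close>

context abelian_maximal
begin

lemma alpha_formula:
  "alpha G n * order G =
    card (center G) * (p * card A) ^ n + (card A - card (center G)) * card A ^ n
      + (p * card A - card A) * (p * card (center G)) ^ n"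
  unfolding alpha_sum[OF finite_carrier]
  using sum_over_centralizers[of "\<lambda>X. card X ^ n" "(p * card (center G)) ^ n"] index
  by (simp add: card_centralizer_notin_A order_def)

lemma commuting_tuples_in_centralizer:
  assumes "g \<in> carrier G" "g \<notin> center G"
  shows "{xs \<in> commuting_tuples G n. set xs \<subseteq> centralizer G g}
    = {xs. set xs \<subseteq> centralizer G g \<and> length xs = n}"
proof (intro Set.set_eqI iffI)
  fix xs assume xs: "xs \<in> {xs. set xs \<subseteq> centralizer G g \<and> length xs = n}"
  have "x \<otimes> y = y \<otimes> x" if "x \<in> set xs" "y \<in> set xs" for x y
    using centralizer_abelian[OF assms] that xs by blast
  then show "xs \<in> {xs \<in> commuting_tuples G n. set xs \<subseteq> centralizer G g}"
    using xs centralizer_subset[of g] by (auto simp: commuting_tuples_iff)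
qed (auto simp: commuting_tuples_iff)

text \<open>A central first entry imposes no condition on the rest. For a noncentral one the
  centralizer is abelian, so every tuple in it commutes and only its order enters.\<close>

lemma card_commuting_tuples_recursion:
  "card (commuting_tuples G (Suc n)) =
    card (center G) * card (commuting_tuples G n) + (card A - card (center G)) * card A ^ n
      + (p * card A - card A) * (p * card (center G)) ^ n"
proof -
  let ?f = "\<lambda>X. card {xs \<in> commuting_tuples G n. set xs \<subseteq> X}"
  have f: "?f (centralizer G g) = card (centralizer G g) ^ n"
    if "g \<in> carrier G" "g \<notin> center G" for g
    unfolding commuting_tuples_in_centralizer[OF that]
    using finite_carrier finite_subset[OF centralizer_subset] by (simp add: card_lists_length_eq)
  have "?f (carrier G) = card (commuting_tuples G n)"
    by (rule arg_cong[of _ _ card]) (auto simp: commuting_tuples_iff)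
  moreover have "?f A = card A ^ n"
  proof -
    have "{xs \<in> commuting_tuples G n. set xs \<subseteq> A} = {xs. set xs \<subseteq> A \<and> length xs = n}"
      using A_subset by (auto simp: commuting_tuples_iff intro: abelian)
    then show ?thesis using finite_A by (simp add: card_lists_length_eq)
  qed
  moreover have "?f (centralizer G g) = (p * card (center G)) ^ n"
    if "g \<in> carrier G" "g \<notin> A" for g
    using f[of g] card_centralizer_notin_A[OF that] that center_subset_A by (auto simp: subset_iff)
  ultimately show ?thesis
    unfolding card_commuting_tuples_Suc[OF finite_carrier]
    using sum_over_centralizers[of ?f "(p * card (center G)) ^ n"] index
    by (simp add: order_def)
qed

end

section \<open>Coefficients of the generating functions when the center has index
  \<open>p ^ 4\<close>\<close>

lemma fps_geometric_nth:
  fixes a c :: "'a :: field"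
  shows "fps_nth (fps_const a / (1 - fps_const c * fps_X)) n = a * c ^ n"
proof -
  let ?g = "Abs_fps (\<lambda>n. a * c ^ n)" and ?d = "1 - fps_const c * fps_X :: 'a fps"
  \<comment> \<open>The product telescopes: each coefficient after the first is
    \<open>a * c ^ n\<close> minus \<open>c\<close> times its predecessor.\<close>
  have "?g * ?d = fps_const a"
  proof (rule fps_ext)
    fix n
    show "fps_nth (?g * ?d) n = fps_nth (fps_const a) n"
      by (cases n) (simp_all add: right_diff_distrib mult.assoc[symmetric] mult.commute[of ?g])
  qed
  moreover have "fps_nth ?d 0 \<noteq> 0" by simp
  ultimately have "fps_const a / ?d = ?g"
    by (metis fps_zero_nth nonzero_mult_div_cancel_right)
  then show ?thesis by simp
qed

lemma fps_compose_scaled_X_nth: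
  fixes f :: "'a :: field fps"
  shows "fps_nth (fps_compose f (fps_const c * fps_X)) n = c ^ n * fps_nth f n"
  by simp

locale abelian_maximal_rank5 = abelian_maximal +
  assumes center_index: "order G = p ^ 4 * card (center G)"
begin

lemma card_A: "card A = p ^ 3 * card (center G)"
  using index prime_gt_0_nat[OF p] unfolding center_index by (simp add: numeral_eq_Suc)

text \<open>The first term counts the tuples inside \<open>A\<close>. The others each lie in the
  centralizer of an entry outside \<open>A\<close>; there are \<open>p ^ 3\<close> such
  centralizers, of order \<open>p |Z|\<close>, pairwise meeting in the center. The proof by
  induction solves the recursion, over the integers because of the subtractions.\<close>

lemma card_commuting_tuples:
  "int (card (commuting_tuples G n)) =
    (int p ^ 3 * card (center G)) ^ n + int p ^ 3 * (int p ^ n - 1) * int (card (center G)) ^ n"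
proof (induction n)
  case 0
  have "commuting_tuples G 0 = {[]}" by (auto simp: commuting_tuples_iff)
  then show ?case by simp
next
  case (Suc n)
  have "card A \<ge> card (center G)" "p * card A \<ge> card A"
    using card_mono[OF finite_A center_subset_A] prime_gt_0_nat[OF p] by auto
  then have "int (card (commuting_tuples G (Suc n))) =
      int (card (center G)) * int (card (commuting_tuples G n))
      + (int (card A) - int (card (center G))) * int (card A) ^ n
      + (int p * int (card A) - int (card A)) * (int p * int (card (center G))) ^ n"
    unfolding card_commuting_tuples_recursion by (simp add: of_nat_diff)
  then show ?case
    unfolding Suc.IH card_A by (simp add: algebra_simps power_mult_distrib numeral_eq_Suc)
qed

lemma A_series_nth:
  "fps_nth (A_series G) n / of_nat (order G) ^ n =
    (1 - 1 / of_nat p) * (1 / of_nat p ^ 3) ^ n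
    + (1 / of_nat p - 1 / of_nat p ^ 4) * (1 / of_nat p) ^ n + 1 / of_nat p ^ 4"
proof -
  define P Z :: rat where "P = of_nat p" and "Z = of_nat (card (center G))"
  have P0: "P \<noteq> 0" and Z0: "Z \<noteq> 0"
    using prime_gt_0_nat[OF p] card_center_pos by (auto simp: P_def Z_def)
  have N: "of_nat (order G) = P ^ 4 * Z" unfolding center_index P_def Z_def by simp
  have "card A \<ge> card (center G)" "p * card A \<ge> card A"
    using card_mono[OF finite_A center_subset_A] prime_gt_0_nat[OF p] by auto
  then have "of_nat (alpha G n * order G) =
    (Z * (P ^ 4 * Z) ^ n + (P ^ 3 * Z - Z) * (P ^ 3 * Z) ^ n
      + (P ^ 4 * Z - P ^ 3 * Z) * (P * Z) ^ n)"
    unfolding alpha_formula by (simp add: of_nat_diff card_A P_def Z_def numeral_eq_Suc mult.assoc)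
  then have alpha: "of_nat (alpha G n) =
    (Z * (P ^ 4 * Z) ^ n + (P ^ 3 * Z - Z) * (P ^ 3 * Z) ^ n
      + (P ^ 4 * Z - P ^ 3 * Z) * (P * Z) ^ n) / (P ^ 4 * Z)"
    using P0 Z0 by (simp add: N eq_divide_eq)
  \<comment> \<open>Naming the \<open>n\<close>-th powers leaves an identity of rational functions
    in \<open>P\<close>, \<open>Z\<close>, \<open>Q\<close> and \<open>Y\<close>, free of the
    exponent \<open>n\<close>.\<close>
  define Q Y where "Q = P ^ n" and "Y = Z ^ n"
  have QY: "Q \<noteq> 0" "Y \<noteq> 0" using P0 Z0 by (auto simp: Q_def Y_def)
  have pow: "(P ^ k * Z) ^ n = Q ^ k * Y" "(P * Z) ^ n = Q * Y" "(1 / P ^ k) ^ n = 1 / Q ^ k"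
    "(1 / P) ^ n = 1 / Q" for k
    by (simp_all add: Q_def Y_def power_mult_distrib power_divide power_mult[symmetric] mult.commute)
  show ?thesis
    using P0 Z0 QY unfolding A_series_def N P_def[symmetric] fps_nth_Abs_fps alpha pow
    by (simp add: divide_simps) (simp add: algebra_simps numeral_eq_Suc)
qed

lemma B_series_nth:
  "fps_nth (B_series G) n / of_nat (order G) ^ n =
    - (1 / of_nat p) * (1 / of_nat p ^ 4) ^ n + (1 / of_nat p ^ 3) ^ n
    + 1 / of_nat p * (1 / of_nat p) ^ n"
proof -
  define P Z :: rat where "P = of_nat p" and "Z = of_nat (card (center G))"
  have P0: "P \<noteq> 0" and Z0: "Z \<noteq> 0"
    using prime_gt_0_nat[OF p] card_center_pos by (auto simp: P_def Z_def)
  have N: "of_nat (order G) = P ^ 4 * Z" unfolding center_index P_def Z_def by simp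
  have "of_nat (beta G n * order G) = (of_int (int (card (commuting_tuples G (Suc n)))) :: rat)"
    unfolding beta_commuting_tuples[OF finite_carrier] by simp
  also have "\<dots> = (P ^ 3 * Z) ^ Suc n + P ^ 3 * (P ^ Suc n - 1) * Z ^ Suc n"
    unfolding card_commuting_tuples by (simp add: P_def Z_def)
  finally have beta: "of_nat (beta G n) =
    ((P ^ 3 * Z) ^ Suc n + P ^ 3 * (P ^ Suc n - 1) * Z ^ Suc n) / (P ^ 4 * Z)"
    using P0 Z0 by (simp add: N eq_divide_eq)
  define Q Y where "Q = P ^ n" and "Y = Z ^ n"
  have QY: "Q \<noteq> 0" "Y \<noteq> 0" using P0 Z0 by (auto simp: Q_def Y_def)
  have pow: "(P ^ k * Z) ^ n = Q ^ k * Y" "(P * Z) ^ n = Q * Y" "(1 / P ^ k) ^ n = 1 / Q ^ k"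
    "(1 / P) ^ n = 1 / Q" for k
    by (simp_all add: Q_def Y_def power_mult_distrib power_divide power_mult[symmetric] mult.commute)
  show ?thesis
    using P0 Z0 QY
    unfolding B_series_def N P_def[symmetric] fps_nth_Abs_fps beta pow power_Suc
      Q_def[symmetric] Y_def[symmetric]
    by (simp add: divide_simps) (simp add: algebra_simps numeral_eq_Suc)
qed

lemma series_formulas:
  "fps_compose (A_series G) (fps_const (1 / of_nat (order G)) * fps_X) =
      fps_const (1 - 1 / of_nat p) / (1 - fps_const (1 / of_nat p ^ 3) * fps_X)
      + fps_const (1 / of_nat p - 1 / of_nat p ^ 4) / (1 - fps_const (1 / of_nat p) * fps_X)
      + fps_const (1 / of_nat p ^ 4) / (1 - fps_X)" (is ?A)
  "fps_compose (B_series G) (fps_const (1 / of_nat (order G)) * fps_X) =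
      fps_const (- (1 / of_nat p)) / (1 - fps_const (1 / of_nat p ^ 4) * fps_X)
      + 1 / (1 - fps_const (1 / of_nat p ^ 3) * fps_X)
      + fps_const (1 / of_nat p) / (1 - fps_const (1 / of_nat p) * fps_X)" (is ?B)
proof -
  \<comment> \<open>The geometric series with \<open>c = 1\<close> and, below, with
    \<open>a = 1\<close>, in the shapes in which they occur in the two formulas.\<close>
  have one: "fps_nth (fps_const a / (1 - fps_X)) n = a" for a :: rat and n
    using fps_geometric_nth[of a 1 n] by simp
  have one': "fps_nth (1 / (1 - fps_const c * fps_X)) n = c ^ n" for c :: rat and n
    using fps_geometric_nth[of 1 c n] by simp
  show ?A
    by (rule fps_ext) (use A_series_nth in
      \<open>simp only: fps_compose_scaled_X_nth fps_add_nth fps_geometric_nth one\<close>,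
      simp add: power_divide)
  show ?B
    by (rule fps_ext) (use B_series_nth in
      \<open>simp only: fps_compose_scaled_X_nth fps_add_nth fps_geometric_nth one'\<close>,
      simp add: power_divide)
qed

end

section \<open>Isoclinism invariance\<close>

lemma (in group_hom) subgroup_preimage:
  assumes K: "subgroup K H"
  shows "subgroup {g \<in> carrier G. h g \<in> K} G"
proof (rule G.subgroupI)
  show "{g \<in> carrier G. h g \<in> K} \<noteq> {}" using subgroup.one_closed[OF K] by force
qed (use K in \<open>auto simp: subgroup.m_closed subgroup.m_inv_closed\<close>)

lemma (in group) card_Union_rcosets:
  assumes K: "subgroup K G" and fin: "finite (carrier G)" and X: "X \<subseteq> rcosets K"
  shows "card (\<Union>X) = card K * card X"
proof -
  have UX: "\<Union>X \<subseteq> carrier G" using X rcosets_part_G[OF K] by blast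
  have "card K * card X = card (\<Union>X)"
  proof (rule card_partition)
    show "finite (\<Union>X)" using UX fin finite_subset by blast
    then show "finite X" by (rule finite_UnionD)
    show "card c = card K" if "c \<in> X" for c
      using card_rcosets_equal[OF _ subgroup.subset[OF K]] that X by auto
    show "c1 \<inter> c2 = {}" if "c1 \<in> X" "c2 \<in> X" "c1 \<noteq> c2" for c1 c2
      using rcos_disjoint[OF K] that X by (auto simp: pairwise_def disjnt_def)
  qed
  then show ?thesis by simp
qed

text \<open>With inverted arguments the commutator takes the form of the elements that generate
  \<open>derived\<close>.\<close>

lemma (in group) commutator_in_derived:
  assumes "x \<in> carrier G" "y \<in> carrier G"
  shows "commutator G x y \<in> derived G (carrier G)"
proof -
  have "commutator G x y = inv x \<otimes> inv y \<otimes> inv (inv x) \<otimes> inv (inv y)"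
    using assms by (simp add: commutator_def)
  then show ?thesis
    unfolding derived_def using assms by (intro generate.incl) (blast intro: inv_closed)
qed

text \<open>\<open>B\<close> is the preimage in \<open>G\<close> of the image of \<open>A\<close>
  modulo the center, taken through \<open>\<theta>\<close>. Commutators of elements of
  \<open>B\<close> are sent by \<open>\<phi>\<close> to commutators in \<open>A\<close>, which are
  trivial, and \<open>\<phi>\<close> is injective. Since \<open>\<theta>\<close> matches cosets of
  the centers, the indices over the centers agree; they are stated as cross products.\<close>

lemma isoclinic_abelian_subgroup:
  fixes G :: "('a, 'b) monoid_scheme" and H :: "('c, 'd) monoid_scheme"
  assumes "group G" and "group H" and finG: "finite (carrier G)" and finH: "finite (carrier H)"
    and iso: "isoclinic G H"
    and A: "subgroup A H" and ZA: "center H \<subseteq> A"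
    and abelian: "\<And>x y. x \<in> A \<Longrightarrow> y \<in> A \<Longrightarrow> x \<otimes>\<^bsub>H\<^esub> y = y \<otimes>\<^bsub>H\<^esub> x"
  obtains B where "subgroup B G" "\<And>x y. x \<in> B \<Longrightarrow> y \<in> B \<Longrightarrow> x \<otimes>\<^bsub>G\<^esub> y = y \<otimes>\<^bsub>G\<^esub> x"
    and "card B * card (center H) = card (center G) * card A"
    and "order G * card (center H) = card (center G) * order H"
proof -
  interpret G: group G by fact
  interpret H: group H by fact
  interpret ZG: normal "center G" G by (rule G.normal_center)
  interpret ZH: normal "center H" H by (rule H.normal_center)
  interpret QG: group "G Mod center G" by (rule ZG.factorgroup_is_group)
  interpret QH: group "H Mod center H" by (rule ZH.factorgroup_is_group)
  obtain \<theta> \<phi> where \<theta>: "\<theta> \<in> iso (G Mod center G) (H Mod center H)"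
    and \<phi>: "\<phi> \<in> iso (derived_group G) (derived_group H)"
    and comm: "\<And>g1 g2 h1 h2. \<lbrakk>g1 \<in> carrier G; g2 \<in> carrier G; h1 \<in> carrier H; h2 \<in> carrier H;
      \<theta> (center G #>\<^bsub>G\<^esub> g1) = center H #>\<^bsub>H\<^esub> h1;
      \<theta> (center G #>\<^bsub>G\<^esub> g2) = center H #>\<^bsub>H\<^esub> h2\<rbrakk>
      \<Longrightarrow> \<phi> (commutator G g1 g2) = commutator H h1 h2"
    using iso unfolding isoclinic_def by blast
  have bij: "bij_betw \<theta> (rcosets\<^bsub>G\<^esub> center G) (rcosets\<^bsub>H\<^esub> center H)"
    using \<theta> by (simp add: iso_def FactGroup_def)
  interpret f: group_hom G "H Mod center H" "\<lambda>g. \<theta> (center G #>\<^bsub>G\<^esub> g)"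
  proof unfold_locales
    have "\<theta> \<in> hom (G Mod center G) (H Mod center H)" using \<theta> by (simp add: iso_def)
    from Group.hom_compose[OF ZG.r_coset_hom_Mod this]
    show "(\<lambda>g. \<theta> (center G #>\<^bsub>G\<^esub> g)) \<in> hom G (H Mod center H)" by (simp add: comp_def)
  qed
  interpret \<pi>: group_hom H "H Mod center H" "\<lambda>h. center H #>\<^bsub>H\<^esub> h"
    by unfold_locales (rule ZH.r_coset_hom_Mod)
  define X where "X = (\<lambda>h. center H #>\<^bsub>H\<^esub> h) ` A"
  define Y where "Y = {C \<in> rcosets\<^bsub>G\<^esub> center G. \<theta> C \<in> X}"
  define B where "B = {g \<in> carrier G. \<theta> (center G #>\<^bsub>G\<^esub> g) \<in> X}"
  have AH: "A \<subseteq> carrier H" using A by (rule subgroup.subset)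
  have X: "X \<subseteq> rcosets\<^bsub>H\<^esub> center H" using AH by (auto simp: X_def RCOSETS_def)
  have "\<Union>X = A"
  proof
    show "\<Union>X \<subseteq> A" unfolding X_def r_coset_def using A ZA by (auto intro: subgroup.m_closed)
    show "A \<subseteq> \<Union>X" unfolding X_def using AH H.rcos_self[OF _ H.subgroup_center] by blast
  qed
  then have cardA: "card A = card (center H) * card X"
    using H.card_Union_rcosets[OF H.subgroup_center finH X] by simp
  have "\<Union>Y = B"
  proof
    show "\<Union>Y \<subseteq> B"
    proof
      fix g assume "g \<in> \<Union>Y"
      then obtain x where x: "x \<in> carrier G" "g \<in> center G #>\<^bsub>G\<^esub> x" "\<theta> (center G #>\<^bsub>G\<^esub> x) \<in> X"
        by (auto simp: Y_def RCOSETS_def)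
      then have "center G #>\<^bsub>G\<^esub> x = center G #>\<^bsub>G\<^esub> g"
        using G.repr_independence G.subgroup_center by blast
      moreover have "g \<in> carrier G"
        using x G.r_coset_subset_G G.center_subset by blast
      ultimately show "g \<in> B" using x by (simp add: B_def)
    qed
    show "B \<subseteq> \<Union>Y" unfolding Y_def B_def RCOSETS_def
      using G.rcos_self[OF _ G.subgroup_center] by blast
  qed
  then have "card B = card (center G) * card Y"
    using G.card_Union_rcosets[OF G.subgroup_center finG, of Y] by (simp add: Y_def)
  moreover have "bij_betw \<theta> Y X"
  proof (rule bij_betw_subset[OF bij])
    have "rcosets\<^bsub>H\<^esub> center H = \<theta> ` (rcosets\<^bsub>G\<^esub> center G)"
      using bij by (simp add: bij_betw_def)
    then show "\<theta> ` Y = X" using X by (auto simp: Y_def)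
  qed (simp add: Y_def)
  ultimately have cardB: "card B = card (center G) * card X"
    by (simp add: bij_betw_same_card)
  have B: "subgroup B G"
    unfolding B_def X_def using f.subgroup_preimage \<pi>.subgroup_img_is_subgroup[OF A] by blast
  have "x \<otimes>\<^bsub>G\<^esub> y = y \<otimes>\<^bsub>G\<^esub> x" if x: "x \<in> B" and y: "y \<in> B" for x y
  proof -
    have xy: "x \<in> carrier G" "y \<in> carrier G" using x y by (auto simp: B_def)
    obtain h k where h: "h \<in> A" "\<theta> (center G #>\<^bsub>G\<^esub> x) = center H #>\<^bsub>H\<^esub> h"
      and k: "k \<in> A" "\<theta> (center G #>\<^bsub>G\<^esub> y) = center H #>\<^bsub>H\<^esub> k"
      using x y by (auto simp: B_def X_def)
    have hk: "h \<in> carrier H" "k \<in> carrier H" using h k AH by auto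
    interpret DG: group "derived_group G" unfolding derived_group_def
      by (rule G.subgroup_imp_group[OF G.derived_is_subgroup]) simp
    interpret DH: group "derived_group H" unfolding derived_group_def
      by (rule H.subgroup_imp_group[OF H.derived_is_subgroup]) simp
    interpret \<phi>: group_hom "derived_group G" "derived_group H" \<phi>
      using \<phi> by unfold_locales (simp add: iso_def)
    have "\<phi> (commutator G x y) = \<one>\<^bsub>H\<^esub>"
      using comm[OF xy hk h(2) k(2)] H.commutator_eq_one_iff[OF hk] abelian[OF h(1) k(1)] by simp
    also have "\<dots> = \<phi> \<one>\<^bsub>G\<^esub>" using \<phi>.hom_one by (simp add: derived_group_def)
    finally have "commutator G x y = \<one>\<^bsub>G\<^esub>"
      using \<phi> G.commutator_in_derived[OF xy] DG.one_closed
      by (auto simp: iso_def bij_betw_def derived_group_def dest: inj_onD)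
    then show ?thesis using G.commutator_eq_one_iff[OF xy] by simp
  qed
  moreover have "card B * card (center H) = card (center G) * card A"
    by (simp add: cardA cardB)
  moreover have "order G * card (center H) = card (center G) * order H"
    using G.lagrange[OF G.subgroup_center] H.lagrange[OF H.subgroup_center]
      bij_betw_same_card[OF bij] by (metis mult.assoc mult.commute)
  ultimately show thesis using that B by blast
qed

section \<open>Groups of maximal class with an abelian maximal subgroup\<close>

context group
begin

text \<open>If \<open>y\<close> normalizes \<open>K\<close> and a positive power of \<open>y\<close>
  lies in \<open>K\<close>, this is the subgroup generated by \<open>y\<close> and \<open>K\<close>,
  with natural exponents only.\<close>

definition cyclic_extension :: "'a \<Rightarrow> 'a set \<Rightarrow> 'a set" where
  "cyclic_extension y K = {y [^] n \<otimes> k | (n :: nat) k. k \<in> K}"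

lemma mem_of_coprime_powers:
  fixes m n :: nat
  assumes K: "subgroup K G" and y: "y \<in> carrier G"
    and m: "y [^] m \<in> K" and n: "y [^] n \<in> K" and "coprime m n"
  shows "y \<in> K"
proof -
  obtain u v where uv: "u * int m + v * int n = 1"
    using bezout_int[of "int m" "int n"] \<open>coprime m n\<close> by (auto simp: coprime_iff_gcd_eq_1)
  have "y [^] (1 :: int) = (y [^] m) [^] u \<otimes> (y [^] n) [^] v"
    using y unfolding uv[symmetric]
    by (simp add: int_pow_mult int_pow_pow int_pow_int[symmetric] mult.commute)
  moreover have "(y [^] m) [^] u \<otimes> (y [^] n) [^] v \<in> K"
    using subgroup_int_pow_closed[OF K m] subgroup_int_pow_closed[OF K n]
    by (rule subgroup.m_closed[OF K])
  ultimately show ?thesis using y by simp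
qed

lemma coprime_prime_less: "prime p \<Longrightarrow> 0 < n \<Longrightarrow> n < p \<Longrightarrow> coprime p (n :: nat)"
  using prime_imp_coprime nat_dvd_not_less by blast

context
  fixes K y p
  assumes K: "subgroup K G" and y: "y \<in> carrier G" and p: "prime (p :: nat)"
    and pow: "y [^] p \<in> K" and normalizes: "\<And>k. k \<in> K \<Longrightarrow> inv y \<otimes> k \<otimes> y \<in> K"
begin

lemma cyclic_extension_commute:
  assumes "k \<in> K"
  shows "\<exists>k'\<in>K. k \<otimes> y [^] (n :: nat) = y [^] n \<otimes> k'"
proof (induction n)
  case 0
  then show ?case using assms subgroup.mem_carrier[OF K] by force
next
  case (Suc n)
  then obtain k' where k': "k' \<in> K" "k \<otimes> y [^] n = y [^] n \<otimes> k'" by blast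
  have kc: "k \<in> carrier G" "k' \<in> carrier G" using assms k' subgroup.mem_carrier[OF K] by auto
  have "k \<otimes> y [^] Suc n = y [^] n \<otimes> k' \<otimes> y"
    using y kc k'(2) by (simp add: m_assoc[symmetric])
  also have "\<dots> = y [^] Suc n \<otimes> (inv y \<otimes> k' \<otimes> y)"
    using y kc by (simp add: m_assoc[symmetric]) (simp add: m_assoc)
  finally show ?case using normalizes[OF k'(1)] by blast
qed

lemma cyclic_extension_less:
  "cyclic_extension y K = {y [^] n \<otimes> k | n k. n < p \<and> k \<in> K}"
proof
  show "cyclic_extension y K \<subseteq> {y [^] n \<otimes> k | n k. n < p \<and> k \<in> K}"
  proof
    fix x assume "x \<in> cyclic_extension y K"
    then obtain n :: nat and k where x: "x = y [^] n \<otimes> k" "k \<in> K"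
      by (auto simp: cyclic_extension_def)
    have kc: "k \<in> carrier G" using x subgroup.mem_carrier[OF K] by auto
    \<comment> \<open>Division with remainder: the second factor lies in \<open>K\<close> and is
      absorbed there.\<close>
    have "y [^] n = y [^] (n mod p) \<otimes> (y [^] p) [^] (n div p)"
      using y by (simp add: nat_pow_pow nat_pow_mult)
    then have "x = y [^] (n mod p) \<otimes> ((y [^] p) [^] (n div p) \<otimes> k)"
      using x y kc by (simp add: m_assoc)
    moreover have "(y [^] p) [^] (n div p) \<in> K"
      using subgroup_int_pow_closed[OF K pow, of "int (n div p)"] by (simp add: int_pow_int)
    then have "(y [^] p) [^] (n div p) \<otimes> k \<in> K" using x K by (simp add: subgroup.m_closed)
    moreover have "n mod p < p" using prime_gt_0_nat[OF p] by simp
    ultimately show "x \<in> {y [^] n \<otimes> k | n k. n < p \<and> k \<in> K}" by blast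
  qed
qed (auto simp: cyclic_extension_def)

lemma subset_cyclic_extension: "insert y K \<subseteq> cyclic_extension y K"
proof -
  have "y = y [^] (1 :: nat) \<otimes> \<one>" using y by simp
  moreover have "k = y [^] (0 :: nat) \<otimes> k" if "k \<in> K" for k
    using that subgroup.mem_carrier[OF K] by simp
  ultimately show ?thesis unfolding cyclic_extension_def using subgroup.one_closed[OF K] by blast
qed

lemma cyclic_extension_subset:
  assumes "subgroup L G" "y \<in> L" "K \<subseteq> L"
  shows "cyclic_extension y K \<subseteq> L"
proof -
  have "y [^] (n :: nat) \<in> L" for n
    using subgroup_int_pow_closed[OF assms(1,2), of "int n"] by (simp add: int_pow_int)
  then show ?thesis using assms unfolding cyclic_extension_def by (auto intro: subgroup.m_closed)
qed

lemma subgroup_cyclic_extension: "subgroup (cyclic_extension y K) G"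
proof (rule subgroupI)
  let ?L = "cyclic_extension y K"
  show sub: "?L \<subseteq> carrier G"
    using cyclic_extension_subset[OF subgroup_self y subgroup.subset[OF K]] .
  show "?L \<noteq> {}" using subset_cyclic_extension by blast
  show mult: "u \<otimes> v \<in> ?L" if u: "u \<in> ?L" and v: "v \<in> ?L" for u v
  proof -
    obtain n m :: nat and k l where u: "u = y [^] n \<otimes> k" "k \<in> K" and v: "v = y [^] m \<otimes> l" "l \<in> K"
      using u v by (auto simp: cyclic_extension_def)
    obtain k' where k': "k' \<in> K" "k \<otimes> y [^] m = y [^] m \<otimes> k'"
      using cyclic_extension_commute[OF u(2)] by blast
    have c: "k \<in> carrier G" "k' \<in> carrier G" "l \<in> carrier G"
      using u v k' subgroup.mem_carrier[OF K] by auto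
    have "u \<otimes> v = y [^] n \<otimes> (k \<otimes> y [^] m) \<otimes> l" using u v c y by (simp add: m_assoc)
    also have "\<dots> = y [^] (n + m) \<otimes> (k' \<otimes> l)"
      using k' c y by (simp add: m_assoc nat_pow_mult[symmetric])
    finally show ?thesis
      unfolding cyclic_extension_def using subgroup.m_closed[OF K k'(1) v(2)] by blast
  qed
  have K_L: "K \<subseteq> ?L" using subset_cyclic_extension by blast
  obtain q where q: "p = Suc q" using prime_gt_0_nat[OF p] gr0_implies_Suc by blast
  \<comment> \<open>As \<open>q = p - 1\<close>, this writes the inverse of \<open>y\<close> with a
    natural exponent and a factor from \<open>K\<close>.\<close>
  have "y [^] q \<otimes> inv (y [^] p) = inv y"
    using y unfolding q nat_pow_Suc2[OF y] by (simp add: inv_mult_group m_assoc[symmetric])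
  then have inv_y: "inv y \<in> ?L"
    using subgroup.m_inv_closed[OF K pow] unfolding cyclic_extension_def
    by (intro CollectI exI[of _ q] exI[of _ "inv (y [^] p)"]) simp
  have inv_pow: "inv (y [^] n) \<in> ?L" for n :: nat
  proof (induction n)
    case 0
    then show ?case using K_L subgroup.one_closed[OF K] by auto
  next
    case (Suc n)
    then show ?case using mult[OF inv_y Suc] y by (simp add: inv_mult_group)
  qed
  show "inv u \<in> ?L" if uL: "u \<in> ?L" for u
  proof -
    obtain n :: nat and k where u: "u = y [^] n \<otimes> k" "k \<in> K"
      using uL by (auto simp: cyclic_extension_def)
    have "inv u = inv k \<otimes> inv (y [^] n)"
      using u y subgroup.mem_carrier[OF K] by (simp add: inv_mult_group)
    then show ?thesis using mult inv_pow K_L subgroup.m_inv_closed[OF K u(2)] by auto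
  qed
qed

text \<open>If two products with exponents \<open>n \<le> m < p\<close> coincide, then
  \<open>y [^] (m - n)\<close> lies in \<open>K\<close>. Were \<open>m - n\<close> positive, it
  would be coprime to \<open>p\<close>, and together with \<open>y [^] p \<in> K\<close> this would
  put \<open>y\<close> into \<open>K\<close>.\<close>

lemma card_cyclic_extension:
  assumes fin: "finite K" and notin: "y \<notin> K"
  shows "card (cyclic_extension y K) = p * card K"
proof -
  let ?f = "\<lambda>(n, k). y [^] (n :: nat) \<otimes> k"
  have le: "n = m \<and> k = l"
    if "n \<le> m" "m < p" "k \<in> K" "l \<in> K" "y [^] n \<otimes> k = y [^] m \<otimes> l" for n m :: nat and k l
  proof -
    have c: "k \<in> carrier G" "l \<in> carrier G" using that subgroup.mem_carrier[OF K] by auto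
    have "y [^] m = y [^] n \<otimes> y [^] (m - n)" using y \<open>n \<le> m\<close> by (simp add: nat_pow_mult)
    then have k: "k = y [^] (m - n) \<otimes> l" using that(5) y c by (simp add: m_assoc)
    then have "y [^] (m - n) = k \<otimes> inv l" using y c by (simp add: m_assoc)
    then have "y [^] (m - n) \<in> K"
      using that K by (simp add: subgroup.m_closed subgroup.m_inv_closed)
    then have "\<not> coprime p (m - n)"
      using mem_of_coprime_powers[OF K y pow] notin by blast
    then have "m - n = 0" using coprime_prime_less[OF p, of "m - n"] that by fastforce
    then show ?thesis using k c that by simp
  qed
  have "inj_on ?f ({..<p} \<times> K)"
  proof (rule inj_onI)
    fix s t assume st: "s \<in> {..<p} \<times> K" "t \<in> {..<p} \<times> K" "?f s = ?f t"
    obtain n k m l where s: "s = (n, k)" and t: "t = (m, l)" by (metis surj_pair)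
    have *: "n < p" "m < p" "k \<in> K" "l \<in> K" "y [^] n \<otimes> k = y [^] m \<otimes> l"
      using st unfolding s t by simp_all
    have "n \<le> m \<or> m \<le> n" by (rule linear)
    then have "n = m \<and> k = l"
      using le[OF _ *(2-5)] le[OF _ *(1) *(4) *(3) *(5)[symmetric]] by blast
    then show "s = t" unfolding s t by simp
  qed
  moreover have "?f ` ({..<p} \<times> K) = cyclic_extension y K"
    unfolding cyclic_extension_less by auto
  ultimately have "card (cyclic_extension y K) = card ({..<p} \<times> K)"
    using card_image by metis
  then show ?thesis by (simp add: card_cartesian_product)
qed

end

end

text \<open>Here \<open>b i\<close> stands for \<alpha>_(i+1), and the sequence becomes trivial at
  index \<open>r\<close>. Of the power relations on the \<alpha>_i, \<open>b_pow\<close> retains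
  only that each \<open>p\<close>-th power lies in the subgroup generated by the later terms. The
  assumption \<open>b_last\<close> alone rules out a collapse of the group.\<close>

locale maximal_class = group G for G :: "('a, 'b) monoid_scheme" (structure) +
  fixes p r :: nat and a :: 'a and b :: "nat \<Rightarrow> 'a"
  assumes p: "prime p" and r: "2 \<le> r"
    and a: "a \<in> carrier G" and b: "\<And>i. b i \<in> carrier G"
    and b_commute: "\<And>i j. b i \<otimes> b j = b j \<otimes> b i"
    and b_a: "\<And>i. b i \<otimes> a = a \<otimes> b i \<otimes> b (Suc i)"
    and b_eq_one: "\<And>i. r \<le> i \<Longrightarrow> b i = \<one>"
    and b_last: "b (r - 1) \<noteq> \<one>"
    and b_pow: "\<And>i. b i [^] p \<in> generate G (b ` {Suc i..})"
    and a_pow: "a [^] p = \<one>"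
    and generated: "carrier G \<subseteq> generate G (insert a (range b))"
begin

section \<open>The descending chain \<open>B i\<close> and the commutator map with
  \<open>a\<close>\<close>

definition B :: "nat \<Rightarrow> 'a set" where
  "B i = generate G (b ` {i..})"

text \<open>On the abelian subgroup \<open>B 0\<close>, the map \<open>D x = [x, a]\<close> is an endomorphism sending each \<open>b i\<close> to
  \<open>b (i + 1)\<close>; its kernel there is the center.\<close>

definition D :: "'a \<Rightarrow> 'a" where
  "D x = inv x \<otimes> (inv a \<otimes> x \<otimes> a)"

lemma subgroup_B: "subgroup (B i) G"
  unfolding B_def using b by (intro generate_is_subgroup) auto

lemma B_carrier: "x \<in> B i \<Longrightarrow> x \<in> carrier G"
  using subgroup.mem_carrier[OF subgroup_B] .

lemma B_antimono: "i \<le> j \<Longrightarrow> B j \<subseteq> B i"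
  unfolding B_def by (intro mono_generate image_mono) auto

lemma B_subset_iff: "subgroup L G \<Longrightarrow> B i \<subseteq> L \<longleftrightarrow> (\<forall>j\<ge>i. b j \<in> L)"
  unfolding B_def using generate_subgroup_incl[of "b ` {i..}" L] generate.incl[of _ "b ` {i..}" G]
  by blast

lemma b_in_B: "i \<le> j \<Longrightarrow> b j \<in> B i"
  using B_subset_iff[OF subgroup_B] by blast

text \<open>First every generator centralizes \<open>B 0\<close>; hence the centralizer of any
  element of \<open>B 0\<close> contains all generators and so \<open>B 0\<close>.\<close>

lemma B_commute:
  assumes "x \<in> B i" "y \<in> B j"
  shows "x \<otimes> y = y \<otimes> x"
proof -
  have x: "x \<in> B 0" and y: "y \<in> B 0" using assms B_antimono[of 0] by blast+
  have "B 0 \<subseteq> centralizer G (b i)" for i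
    using B_subset_iff[OF subgroup_centralizer[OF b]] b b_commute by (auto simp: centralizer_def)
  then have "b i \<in> centralizer G x" for i
    using x B_carrier mem_centralizer_commute b by blast
  then have "B 0 \<subseteq> centralizer G x"
    using B_subset_iff subgroup_centralizer B_carrier x by blast
  then show ?thesis using y by (auto simp: centralizer_def)
qed

lemma D_closed: "x \<in> carrier G \<Longrightarrow> D x \<in> carrier G"
  unfolding D_def using a by simp

lemma conj_a: "x \<in> carrier G \<Longrightarrow> inv a \<otimes> x \<otimes> a = x \<otimes> D x"
  unfolding D_def using a by (simp add: m_assoc[symmetric])

lemma D_eq_one_iff: "x \<in> carrier G \<Longrightarrow> D x = \<one> \<longleftrightarrow> a \<otimes> x = x \<otimes> a"
proof -
  assume x: "x \<in> carrier G"
  have "D x = commutator G x a" using x a by (simp add: D_def commutator_def m_assoc)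
  then show ?thesis using commutator_eq_one_iff[OF x a] by (simp add: eq_commute)
qed

lemma D_b: "D (b i) = b (Suc i)"
  using a b by (simp add: D_def m_assoc b_a) (simp add: m_assoc[symmetric])

text \<open>Conjugation by \<open>a\<close> is multiplicative, and \<open>D x\<close> can pass
  \<open>inv y\<close> because both lie in the abelian \<open>B 0\<close>. The membership of
  \<open>D x\<close> is an assumption since \<open>D_B\<close> is derived from this lemma.\<close>

lemma D_mult:
  assumes x: "x \<in> B 0" "D x \<in> B 0" and y: "y \<in> B 0"
  shows "D (x \<otimes> y) = D x \<otimes> D y"
proof -
  have c: "x \<in> carrier G" "y \<in> carrier G" using x y B_carrier by auto
  have iy: "inv y \<in> B 0" using y subgroup.m_inv_closed[OF subgroup_B] by blast
  have "inv a \<otimes> (x \<otimes> y) \<otimes> a = (inv a \<otimes> x \<otimes> a) \<otimes> (inv a \<otimes> y \<otimes> a)"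
    using c a by (simp add: m_assoc) (simp add: m_assoc[symmetric])
  then have "D (x \<otimes> y) = inv y \<otimes> D x \<otimes> (inv a \<otimes> y \<otimes> a)"
    unfolding D_def using c a by (simp add: inv_mult_group m_assoc)
  also have "\<dots> = D x \<otimes> inv y \<otimes> (inv a \<otimes> y \<otimes> a)"
    using B_commute[OF iy x(2)] by simp
  also have "\<dots> = D x \<otimes> D y"
    using c a D_closed by (simp add: D_def[of y] m_assoc)
  finally show ?thesis .
qed

text \<open>The elements of \<open>B i\<close> that \<open>D\<close> sends into
  \<open>B (Suc i)\<close> form a subgroup, because \<open>D\<close> is multiplicative on them, and
  this subgroup contains the generators \<open>b j\<close> of \<open>B i\<close>.\<close>

lemma D_B: "x \<in> B i \<Longrightarrow> D x \<in> B (Suc i)"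
proof -
  have B0: "B j \<subseteq> B 0" for j by (rule B_antimono) simp
  let ?S = "{x \<in> B i. D x \<in> B (Suc i)}"
  have S: "subgroup ?S G"
  proof (rule subgroupI)
    show "?S \<subseteq> carrier G" using B_carrier by blast
    have "D \<one> = \<one>" using a by (simp add: D_def)
    then have "\<one> \<in> ?S" using subgroup.one_closed[OF subgroup_B] by simp
    then show "?S \<noteq> {}" by blast
    show "inv x \<in> ?S" if "x \<in> ?S" for x
    proof -
      have x: "x \<in> carrier G" "x \<in> B i" "D x \<in> B (Suc i)" using that B_carrier by auto
      have "D x \<otimes> D (inv x) = D (x \<otimes> inv x)"
        using x B0 subgroup.m_inv_closed[OF subgroup_B] D_mult by (metis subsetD)
      also have "\<dots> = \<one>" using x a by (simp add: D_def)
      finally have "D (inv x) = inv (D x)"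
        using x D_closed inv_closed by (metis inv_equality inv_inv)
      then show ?thesis using x subgroup.m_inv_closed[OF subgroup_B] by simp
    qed
    show "x \<otimes> y \<in> ?S" if "x \<in> ?S" "y \<in> ?S" for x y
    proof -
      have "D (x \<otimes> y) = D x \<otimes> D y" using that B0 by (intro D_mult) blast+
      then show ?thesis using that subgroup.m_closed[OF subgroup_B] by simp
    qed
  qed
  have "B i \<subseteq> ?S" using B_subset_iff[OF S] b_in_B D_b by simp
  then show "x \<in> B i \<Longrightarrow> D x \<in> B (Suc i)" by blast
qed

lemma b_pow_B: "b i [^] p \<in> B (Suc i)"
  unfolding B_def by (rule b_pow)

lemma b_normalizes: "k \<in> B j \<Longrightarrow> inv (b i) \<otimes> k \<otimes> b i \<in> B j"
  using B_commute[OF b_in_B[of 0 i], of k j, symmetric] b B_carrier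
  by (simp add: m_assoc) (simp add: m_assoc[symmetric])

lemma B_eq: "B i = cyclic_extension (b i) (B (Suc i))"
proof
  note ext = subgroup_B b p b_pow_B b_normalizes
  show "cyclic_extension (b i) (B (Suc i)) \<subseteq> B i"
    by (rule cyclic_extension_subset[OF ext]) (auto simp: subgroup_B b_in_B B_antimono)
  have "b j \<in> cyclic_extension (b i) (B (Suc i))" if "i \<le> j" for j
    using subset_cyclic_extension[OF ext] b_in_B[of "Suc i" j] that by (cases "i = j") auto
  then show "B i \<subseteq> cyclic_extension (b i) (B (Suc i))"
    using B_subset_iff[OF subgroup_cyclic_extension[OF ext]] by blast
qed

lemma B_trivial: "r \<le> i \<Longrightarrow> B i = {\<one>}"
  using B_subset_iff[OF triv_subgroup, of i] b_eq_one subgroup.one_closed[OF subgroup_B] by auto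

text \<open>Applying \<open>D\<close> to a membership of \<open>b i\<close> in
  \<open>B (Suc i)\<close> moves it one index up; at the top it would say that
  \<open>b (r - 1)\<close> is trivial.\<close>

lemma b_notin_B: "i < r \<Longrightarrow> b i \<notin> B (Suc i)"
proof (induction "r - 1 - i" arbitrary: i)
  case 0
  then have "i = r - 1" "B (Suc i) = {\<one>}" using B_trivial by auto
  then show ?case using b_last by simp
next
  case (Suc n)
  then have "b (Suc i) \<notin> B (Suc (Suc i))" by simp
  then show ?case using D_B D_b by metis
qed

lemma card_B: "i \<le> r \<Longrightarrow> finite (B i) \<and> card (B i) = p ^ (r - i)"
proof (induction "r - i" arbitrary: i)
  case 0
  then show ?case using B_trivial by simp
next
  case (Suc n)
  then have i: "i < r" and IH: "finite (B (Suc i))" "card (B (Suc i)) = p ^ (r - Suc i)" by auto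
  have "card (B i) = p * card (B (Suc i))"
    by (subst B_eq) (rule card_cyclic_extension[OF subgroup_B b p b_pow_B b_normalizes IH(1) b_notin_B[OF i]])
  also have "\<dots> = p ^ (r - i)" using i IH by (simp flip: power_Suc add: Suc_diff_Suc)
  finally show ?case using prime_gt_0_nat[OF p] card_ge_0_finite[of "B i"] by simp
qed

lemma a_normalizes: "k \<in> B 0 \<Longrightarrow> inv a \<otimes> k \<otimes> a \<in> B 0"
  using conj_a B_carrier D_B B_antimono[of 0 "Suc 0"] subgroup.m_closed[OF subgroup_B]
  by (metis subsetD zero_le)

lemma a_pow_B: "a [^] p \<in> B 0"
  using a_pow subgroup.one_closed[OF subgroup_B] by simp

lemma carrier_eq: "carrier G = cyclic_extension a (B 0)"
proof
  note ext = subgroup_B a p a_pow_B a_normalizes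
  have "insert a (range b) \<subseteq> cyclic_extension a (B 0)"
    using subset_cyclic_extension[OF ext] b_in_B[of 0] by auto
  then show "carrier G \<subseteq> cyclic_extension a (B 0)"
    using generated generate_subgroup_incl subgroup_cyclic_extension[OF ext] by blast
  show "cyclic_extension a (B 0) \<subseteq> carrier G"
    using subgroup_cyclic_extension[OF ext] by (rule subgroup.subset)
qed

lemma a_notin_B: "a \<notin> B 0"
proof
  assume "a \<in> B 0"
  \<comment> \<open>The element \<open>b (r - 2)\<close> is chosen because its commutator with
    \<open>a\<close> is the nontrivial \<open>b (r - 1)\<close>.\<close>
  then have "D (b (r - 2)) = \<one>"
    using B_commute[OF _ b_in_B[of 0]] D_eq_one_iff[OF b] by blast
  moreover have "Suc (r - 2) = r - 1" using r by simp
  ultimately show False using b_last by (simp add: D_b)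
qed

lemma order_eq: "order G = p ^ Suc r"
  unfolding order_def carrier_eq
  using card_cyclic_extension[OF subgroup_B a p a_pow_B a_normalizes _ a_notin_B] card_B[of 0] by simp

text \<open>Write \<open>x = b i [^] n \<otimes> k\<close> with \<open>n < p\<close> and
  \<open>k \<in> B (Suc i)\<close>. Modulo \<open>B (Suc (Suc i))\<close>, \<open>D x\<close> is
  \<open>b (Suc i) [^] n\<close>, which is trivial there only if \<open>n = 0\<close>.\<close>

lemma kernel_step:
  assumes x: "x \<in> B i" and i: "Suc i < r" and D: "D x \<in> B (Suc (Suc i))"
  shows "x \<in> B (Suc i)"
proof -
  note ext = subgroup_B b p b_pow_B b_normalizes
  obtain n k where n: "n < p" and k: "k \<in> B (Suc i)" and eq: "x = b i [^] n \<otimes> k"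
    using x cyclic_extension_less[OF ext, of i] B_eq[of i] by auto
  have bn: "b i [^] n \<in> B i \<and> D (b i [^] n) = b (Suc i) [^] n" for n :: nat
  proof (induction n)
    case 0
    then show ?case using subgroup.one_closed[OF subgroup_B] a by (simp add: D_def)
  next
    case (Suc n)
    have 0: "B j \<subseteq> B 0" for j by (rule B_antimono) simp
    have "D (b i [^] n \<otimes> b i) = D (b i [^] n) \<otimes> D (b i)"
      using Suc 0 D_B b_in_B[of 0] by (intro D_mult) blast+
    then show ?case using Suc subgroup.m_closed[OF subgroup_B] b_in_B[of i i] by (simp add: D_b)
  qed
  have 0: "B j \<subseteq> B 0" for j by (rule B_antimono) simp
  have "D x = D (b i [^] n) \<otimes> D k"
    unfolding eq using bn 0 D_B k by (intro D_mult) blast+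
  then have "D x = b (Suc i) [^] n \<otimes> D k" using bn by simp
  then have "b (Suc i) [^] n = D x \<otimes> inv (D k)"
    using b k D_closed B_carrier by (simp add: m_assoc)
  also have "\<dots> \<in> B (Suc (Suc i))"
    using D D_B[OF k] subgroup_B by (simp add: subgroup.m_closed subgroup.m_inv_closed)
  finally have "b (Suc i) [^] n \<in> B (Suc (Suc i))" .
  then have "\<not> coprime p n"
    using mem_of_coprime_powers[OF subgroup_B b b_pow_B] b_notin_B[OF i] by blast
  then have "n = 0" using coprime_prime_less[OF p _ n] by blast
  then show ?thesis using eq k B_carrier by simp
qed

lemma kernel_D:
  assumes "x \<in> B 0" "D x = \<one>" "i < r"
  shows "x \<in> B i"
  using \<open>i < r\<close>
proof (induction i)
  case 0
  then show ?case using assms by simp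
next
  case (Suc i)
  then show ?case
    using kernel_step[of x i] assms(2) subgroup.one_closed[OF subgroup_B] by simp
qed

text \<open>Write a central element as \<open>a [^] n \<otimes> k\<close>. Then
  \<open>a [^] n\<close> commutes with \<open>b (r - 2)\<close>, while \<open>a\<close> does not, so
  \<open>n = 0\<close>; being in the kernel of \<open>D\<close>, the element descends the chain to
  \<open>B (r - 1)\<close>. Conversely, \<open>D\<close> maps \<open>B (r - 1)\<close> to the
  trivial \<open>B r\<close>.\<close>

lemma center_eq: "center G = B (r - 1)"
proof
  show "center G \<subseteq> B (r - 1)"
  proof
    fix z assume z: "z \<in> center G"
    then have zc: "z \<in> carrier G" using center_subset by blast
    then obtain n k where n: "n < p" and k: "k \<in> B 0" and eq: "z = a [^] n \<otimes> k"
      using cyclic_extension_less[OF subgroup_B a p a_pow_B a_normalizes] carrier_eq by auto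
    let ?c = "b (r - 2)"
    let ?C = "centralizer G ?c"
    have C: "subgroup ?C G" by (rule subgroup_centralizer[OF b])
    have "z \<in> ?C" using center_subset_centralizer[OF b] z by blast
    moreover have "k \<in> ?C"
      using B_commute[OF b_in_B[of 0] k] k B_carrier by (auto simp: centralizer_def)
    moreover have "a [^] n = z \<otimes> inv k" using eq k B_carrier a by (simp add: m_assoc)
    ultimately have "a [^] n \<in> ?C" using C by (simp add: subgroup.m_closed subgroup.m_inv_closed)
    moreover have "a [^] p \<in> ?C" using a_pow subgroup.one_closed[OF C] by simp
    moreover have "a \<notin> ?C"
    proof
      assume "a \<in> ?C"
      then have "D ?c = \<one>" using D_eq_one_iff[OF b] by (auto simp: centralizer_def)
      moreover have "Suc (r - 2) = r - 1" using r by simp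
      ultimately show False using b_last by (simp add: D_b)
    qed
    ultimately have "\<not> coprime p n" using mem_of_coprime_powers[OF C a] by blast
    then have "n = 0" using coprime_prime_less[OF p _ n] by blast
    then have "z \<in> B 0" using eq k B_carrier by simp
    moreover have "D z = \<one>" using z a D_eq_one_iff[OF zc] by (auto simp: center_def)
    ultimately show "z \<in> B (r - 1)" using kernel_D r by simp
  qed
  show "B (r - 1) \<subseteq> center G"
  proof
    fix z assume z: "z \<in> B (r - 1)"
    then have zc: "z \<in> carrier G" using B_carrier by blast
    have "D z \<in> {\<one>}" using D_B[OF z] B_trivial[of "Suc (r - 1)"] by simp
    then have "a \<in> centralizer G z" using a D_eq_one_iff[OF zc] by (simp add: centralizer_def)
    moreover have "range b \<subseteq> centralizer G z"
      using B_commute[OF z b_in_B[of 0]] b by (auto simp: centralizer_def)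
    ultimately have "centralizer G z = carrier G"
      using generate_subgroup_incl[OF _ subgroup_centralizer[OF zc], of "insert a (range b)"]
        generated centralizer_subset by blast
    then show "z \<in> center G" using center_iff_centralizer zc by blast
  qed
qed

lemma card_center: "card (center G) = p"
  unfolding center_eq using card_B[of "r - 1"] r by simp

end

section \<open>The presentation of \<open>\<Phi>\<^sub>9(1\<^sup>5)\<close>\<close>

definition pres_class :: "('g word \<times> 'g word) set \<Rightarrow> 'g word \<Rightarrow> 'g word set" where
  "pres_class R w = pres_rel R `` {w}"

context
  fixes R :: "('g word \<times> 'g word) set"
begin

interpretation group "presented_group R" by (rule group_presented_group)

lemma pres_class_closed: "pres_class R w \<in> carrier (presented_group R)"
  by (simp add: pres_class_def presented_group_def quotientI)

lemma carrier_presented_group: "carrier (presented_group R) = range (pres_class R)"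
  by (auto simp: pres_class_def presented_group_def quotient_def)

lemma pres_class_eq_iff: "pres_class R u = pres_class R v \<longleftrightarrow> (u, v) \<in> pres_rel R"
  by (simp add: pres_class_def eq_equiv_class_iff[OF equiv_pres_rel])

lemma pres_class_relation: "(r, s) \<in> R \<Longrightarrow> pres_class R r = pres_class R s"
  using pres_rel.relation[of r s R "[]" "[]"] by (simp add: pres_class_eq_iff)

lemma pres_class_Nil: "pres_class R [] = \<one>\<^bsub>presented_group R\<^esub>"
  by (simp add: pres_class_def presented_group_def)

lemma pres_class_append:
  "pres_class R (u @ v) = pres_class R u \<otimes>\<^bsub>presented_group R\<^esub> pres_class R v"
  by (simp add: pres_class_def presented_group_mult)

lemma pres_class_inv: "pres_class R (word_inv w) = inv\<^bsub>presented_group R\<^esub> pres_class R w"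
proof -
  have "pres_class R (word_inv w) \<otimes>\<^bsub>presented_group R\<^esub> pres_class R w = \<one>\<^bsub>presented_group R\<^esub>"
    by (simp add: pres_class_append[symmetric] pres_class_Nil[symmetric] pres_class_eq_iff
        pres_rel_word_inv)
  then show ?thesis by (rule inv_equality[symmetric]) (rule pres_class_closed)+
qed

lemma pres_class_pow:
  "pres_class R (word_pow w n) = pres_class R w [^]\<^bsub>presented_group R\<^esub> n"
proof (induction n)
  case 0
  then show ?case by (simp add: word_pow_def pres_class_Nil)
next
  case (Suc n)
  then show ?case
    unfolding nat_pow_Suc2[OF pres_class_closed] by (simp add: word_pow_def pres_class_append)
qed

lemma pres_class_comm:
  "pres_class R (word_comm u v) = commutator (presented_group R) (pres_class R u) (pres_class R v)"
  by (simp add: word_comm_def commutator_def pres_class_append pres_class_inv m_assoc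
      pres_class_closed)

lemma pres_class_concat:
  assumes "subgroup K (presented_group R)" "\<And>w. w \<in> set ws \<Longrightarrow> pres_class R w \<in> K"
  shows "pres_class R (concat ws) \<in> K"
  using assms(2)
proof (induction ws)
  case Nil
  then show ?case using subgroup.one_closed[OF assms(1)] by (simp add: pres_class_Nil)
next
  case (Cons w ws)
  then show ?case using subgroup.m_closed[OF assms(1)] by (simp add: pres_class_append)
qed

lemma presented_group_generated:
  "carrier (presented_group R) = generate (presented_group R) (range (\<lambda>x. pres_class R [(x, False)]))"
    (is "_ = generate _ ?S")
proof
  have S: "?S \<subseteq> carrier (presented_group R)" using pres_class_closed by auto
  show "generate (presented_group R) ?S \<subseteq> carrier (presented_group R)"
    by (rule generate_incl[OF S])
  have "pres_class R w \<in> generate (presented_group R) ?S" for w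
  proof (induction w)
    case Nil
    then show ?case by (simp add: pres_class_Nil generate.one)
  next
    case (Cons l w)
    obtain x e where l: "l = (x, e)" by fastforce
    have x: "pres_class R [(x, False)] \<in> ?S" by blast
    have "pres_class R [(x, True)] = inv\<^bsub>presented_group R\<^esub> pres_class R [(x, False)]"
      using pres_class_inv[of "[(x, False)]"] by (simp add: word_inv_def)
    then have "pres_class R [l] \<in> generate (presented_group R) ?S"
      using generate.incl[OF x] generate.inv[OF x] unfolding l by (cases e) auto
    then show ?case using Cons pres_class_append[of "[l]" w] by (simp add: generate.eng)
  qed
  then show "carrier (presented_group R) \<subseteq> generate (presented_group R) ?S"
    by (auto simp: carrier_presented_group)
qed

end

text \<open>The group \<open>\<Phi>\<^sub>9(1\<^sup>5)\<close> acts on the right on \<open>\<int>/p \<times> \<int>/q\<close>: \<open>\<alpha>\<close> is the shift \<open>(k, c) \<mapsto> (k - 1, c)\<close>, and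
  \<open>\<alpha>\<^sub>i\<close> adds \<open>F i k\<close> to the second coordinate. Here \<open>shift w\<close> and \<open>disp F w k\<close> are what \<open>w\<close> adds to
  the two coordinates of \<open>(k, c)\<close>. The relations ask that \<open>F (i + 1)\<close> be the difference of \<open>F i\<close>.\<close>

fun shift_letter :: "phi9_gen \<times> bool \<Rightarrow> int" where
  "shift_letter (Gen_a, e) = (if e then 1 else - 1)"
| "shift_letter _ = 0"

fun gen_index :: "phi9_gen \<Rightarrow> nat" where
  "gen_index Gen_a = 0"
| "gen_index Gen_a1 = 1"
| "gen_index Gen_a2 = 2"
| "gen_index Gen_a3 = 3"
| "gen_index Gen_a4 = 4"

definition shift :: "phi9_gen word \<Rightarrow> int" where
  "shift w = sum_list (map shift_letter w)"

fun disp :: "(nat \<Rightarrow> int \<Rightarrow> int) \<Rightarrow> phi9_gen word \<Rightarrow> int \<Rightarrow> int" where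
  "disp F [] k = 0"
| "disp F ((x, e) # w) k =
    (if e then - F (gen_index x) k else F (gen_index x) k) + disp F w (k + shift_letter (x, e))"

lemma shift_simps [simp]: "shift [] = 0" "shift (l # w) = shift_letter l + shift w"
    "shift (u @ v) = shift u + shift v"
  by (simp_all add: shift_def)

text \<open>For a right action \<open>v\<close> acts after \<open>u\<close>, so it starts from the
  first coordinate that \<open>u\<close> has reached.\<close>

lemma disp_append: "disp F (u @ v) k = disp F u k + disp F v (k + shift u)"
  by (induction u arbitrary: k) (auto simp: algebra_simps)

text \<open>Index 0 belongs to \<alpha>, which leaves the second coordinate alone; indices above 4
  reflect \<alpha>_j = 1 for j > 4. \<open>F_paren\<close> expresses the power relations on the
  \<alpha>_i, and \<open>F_last\<close> says that \<alpha>_4 moves the points with first coordinate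
  0.\<close>

locale phi9_action =
  fixes p q :: nat and F :: "nat \<Rightarrow> int \<Rightarrow> int"
  assumes F_zero: "\<And>i k. i = 0 \<or> 4 < i \<Longrightarrow> F i k = 0"
    and F_periodic: "\<And>i k k'. [k = k'] (mod int p) \<Longrightarrow> F i k = F i k'"
    and F_diff: "\<And>i k. i \<in> {1..4} \<Longrightarrow> [F i (k + 1) - F i k = F (Suc i) k] (mod int q)"
    and F_paren: "\<And>i k. i \<in> {1..4} \<Longrightarrow>
      [(\<Sum>j<p. int (p choose (j + 1)) * F (i + j) k) = 0] (mod int q)"
    and F_last: "\<not> [F 4 0 = 0] (mod int q)"
begin

lemma disp_periodic: "[k = k'] (mod int p) \<Longrightarrow> disp F w k = disp F w k'"
proof (induction w arbitrary: k k')
  case (Cons l w)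
  obtain x e where l: "l = (x, e)" by fastforce
  have "disp F w (k + shift_letter l) = disp F w (k' + shift_letter l)"
    using Cons by (intro Cons.IH) (simp add: cong_add)
  then show ?case using F_periodic[OF Cons.prems] by (simp add: l)
qed simp

definition acts_equally :: "phi9_gen word \<Rightarrow> phi9_gen word \<Rightarrow> bool" where
  "acts_equally u v \<longleftrightarrow>
    [shift u = shift v] (mod int p) \<and> (\<forall>k. [disp F u k = disp F v k] (mod int q))"

lemma acts_equally_append:
  assumes "acts_equally u u'" "acts_equally v v'"
  shows "acts_equally (u @ v) (u' @ v')"
proof -
  have "disp F v (k + shift u) = disp F v (k + shift u')" for k
    using assms by (intro disp_periodic) (simp add: acts_equally_def cong_add)
  then show ?thesis using assms by (simp add: acts_equally_def disp_append cong_add)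
qed

lemma acts_equally_refl: "acts_equally u u"
  by (simp add: acts_equally_def)

lemma ai_word_action [simp]: "shift (ai_word i) = 0" "disp F (ai_word i) k = F i k"
proof -
  have "i = 1 \<or> i = 2 \<or> i = 3 \<or> i = 4 \<or> i = 0 \<or> 4 < i" by linarith
  then show "shift (ai_word i) = 0" "disp F (ai_word i) k = F i k"
    by (auto simp: ai_word_def F_zero)
qed

lemma word_pow_action:
  assumes "shift w = 0"
  shows "shift (word_pow w n) = 0" "disp F (word_pow w n) k = int n * disp F w k"
proof -
  show "shift (word_pow w n) = 0"
    using assms by (induction n) (simp_all add: word_pow_def)
  show "disp F (word_pow w n) k = int n * disp F w k"
    using assms by (induction n) (simp_all add: word_pow_def disp_append algebra_simps)
qed

lemma paren_word_action:
  "shift (ai_paren_word p i) = 0"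
  "disp F (ai_paren_word p i) k = (\<Sum>j<p. int (p choose (j + 1)) * F (i + j) k)"
proof -
  let ?w = "\<lambda>n. concat (map (\<lambda>j. word_pow (ai_word (i + j)) (p choose (j + 1))) [0..<n])"
  have "shift (?w n) = 0 \<and> disp F (?w n) k = (\<Sum>j<n. int (p choose (j + 1)) * F (i + j) k)" for n
    by (induction n) (simp_all add: disp_append word_pow_action)
  from this[of p] show "shift (ai_paren_word p i) = 0"
    "disp F (ai_paren_word p i) k = (\<Sum>j<p. int (p choose (j + 1)) * F (i + j) k)"
    by (simp_all add: ai_paren_word_def)
qed

lemma word_inv_action:
  "shift (word_inv w) = - shift w" "disp F (word_inv w) k = - disp F w (k - shift w)"
proof -
  have sh: "shift_letter (x, \<not> e) = - shift_letter (x, e)" for x e by (cases x) auto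
  show s: "shift (word_inv w) = - shift w" for w
    by (induction w) (auto simp: word_inv_def sh)
  show "disp F (word_inv w) k = - disp F w (k - shift w)"
  proof (induction w arbitrary: k)
    case (Cons l w)
    obtain x e where l: "l = (x, e)" by fastforce
    \<comment> \<open>A letter either does not shift or is \<alpha> or its inverse, for which
      \<open>F\<close> vanishes.\<close>
    have F0: "F (gen_index x) (k + shift_letter (x, e)) = F (gen_index x) k" for k
      by (cases x) (auto simp: F_zero)
    have "word_inv (l # w) = word_inv w @ [(x, \<not> e)]" by (simp add: word_inv_def l)
    then show ?case
      using F0[of "k - shift w - shift_letter (x, e)"] Cons
      by (simp add: disp_append s l sh algebra_simps)
  qed (simp add: word_inv_def)
qed

lemma relations_act_equally:
  assumes "(u, v) \<in> phi9_relations p"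
  shows "acts_equally u v"
proof -
  have a: "shift a_word = - 1" "disp F a_word k = 0" for k
    by (simp_all add: a_word_def F_zero)
  \<comment> \<open>The commutator subtracts \<open>F i k\<close>, steps to \<open>k + 1\<close>,
    adds \<open>F i (k + 1)\<close> and steps back. For \<open>i = 4\<close> the right-hand word is
    empty.\<close>
  have comm_a: "acts_equally (word_comm (ai_word i) a_word) (ai_word (i + 1))" if "i \<in> {1..4}" for i
    using F_diff[OF that]
    by (simp add: acts_equally_def word_comm_def disp_append word_inv_action a)
  have comm: "acts_equally (word_comm (ai_word i) (ai_word j)) []" for i j
    by (simp add: acts_equally_def word_comm_def disp_append word_inv_action)
  have a_pow: "acts_equally (word_pow a_word p) []"
  proof -
    have "shift (word_pow a_word n) = - int n \<and> disp F (word_pow a_word n) k = 0" for n k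
      by (induction n arbitrary: k) (simp_all add: word_pow_def disp_append a)
    then show ?thesis by (simp add: acts_equally_def cong_def)
  qed
  have paren: "acts_equally (ai_paren_word p i) []" if "i \<in> {1..4}" for i
    using F_paren[OF that] by (simp add: acts_equally_def paren_word_action)
  have "ai_word 5 = []" by (simp add: ai_word_def)
  then show ?thesis
    using assms comm_a[of 1] comm_a[of 2] comm_a[of 3] comm_a[of 4] comm a_pow
      paren[of 1] paren[of 2] paren[of 3] paren[of 4]
    unfolding phi9_relations_def by (auto simp: eval_nat_numeral)
qed

lemma pres_rel_acts_equally: "(u, v) \<in> pres_rel (phi9_relations p) \<Longrightarrow> acts_equally u v"
proof (induction rule: pres_rel.induct)
  case (cancel u x b v)
  have "acts_equally [(x, b), (x, \<not> b)] []"
    by (cases x) (auto simp: acts_equally_def F_zero)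
  then have "acts_equally ([(x, b), (x, \<not> b)] @ v) ([] @ v)"
    using acts_equally_append acts_equally_refl by blast
  then show ?case using acts_equally_append acts_equally_refl by fastforce
next
  case (relation r s u v)
  then show ?case
    by (intro acts_equally_append acts_equally_refl relations_act_equally)
qed (auto simp: acts_equally_def intro: cong_sym cong_trans)

lemma alpha4_nontrivial: "(ai_word 4, []) \<notin> pres_rel (phi9_relations p)"
  using pres_rel_acts_equally[of "ai_word 4" "[]"] F_last by (auto simp: acts_equally_def)

end

text \<open>For \<open>p \<ge> 5\<close> the binomial functions \<open>k \<mapsto> k choose (4 - i)\<close> modulo \<open>p\<close> work, but for \<open>p = 3\<close> the
  cubic one is not periodic modulo \<open>3\<close>. There the \<open>\<alpha>\<^sub>i\<close> have elements of order \<open>9\<close> among them, so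
  \<open>q = 9\<close>, and \<open>F 1 = (1, -1, 0)\<close> is a function with zero sum whose third difference is nonzero.\<close>

lemma phi9_action_3:
  "phi9_action 3 9 (\<lambda>i k. if i = 0 \<or> 4 < i then 0
    else [[1, -1, 0], [-2, 1, 1], [3, 0, -3], [-3, -3, 6]] ! (i - 1) ! nat (k mod 3))"
  (is "phi9_action 3 9 ?F")
proof
  have sum3: "(\<Sum>j<3. f j) = f 0 + f 1 + f 2" for f :: "nat \<Rightarrow> int"
    by (simp add: eval_nat_numeral)
  have choose: "3 choose Suc 0 = 3" "3 choose 2 = 3" "3 choose 3 = 1"
    by (simp_all add: eval_nat_numeral)
  have i: "i = 1 \<or> i = 2 \<or> i = 3 \<or> i = 4" if "i \<in> {1..4}" for i :: nat using that by auto
  have k: "k mod 3 = 0 \<and> (k + 1) mod 3 = 1 \<or> k mod 3 = 1 \<and> (k + 1) mod 3 = 2 \<or>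
      k mod 3 = 2 \<and> (k + 1) mod 3 = 0" for k :: int
    by presburger
  show "?F i k = 0" if "i = 0 \<or> 4 < i" for i k using that by simp
  show "?F i k = ?F i k'" if "[k = k'] (mod int 3)" for i k k'
    using that by (simp add: cong_def)
  \<comment> \<open>Each row after the first lists the cyclic differences of the row above. The
    differences of the last row are 0, 9 and -9, hence zero modulo 9.\<close>
  show "[?F i (k + 1) - ?F i k = ?F (Suc i) k] (mod int 9)" if "i \<in> {1..4}" for i k
    using i[OF that] k[of k] by (elim disjE conjE) (simp_all add: cong_def eval_nat_numeral)
  \<comment> \<open>Three times a function, plus three times its difference, plus its second
    difference, is the sum of three consecutive values; here that is the zero sum of a row.\<close>
  show "[(\<Sum>j<3. int (3 choose (j + 1)) * ?F (i + j) k) = 0] (mod int 9)" if "i \<in> {1..4}" for i k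
    using i[OF that] k[of k] unfolding sum3
    by (elim disjE conjE) (simp_all add: choose cong_def eval_nat_numeral)
  show "\<not> [?F 4 0 = 0] (mod int 9)" by (simp add: cong_def eval_nat_numeral)
qed

lemma phi9_action_ge_5:
  assumes p: "prime p" "5 \<le> p"
  shows "phi9_action p p (\<lambda>i k. if i = 0 \<or> 4 < i then 0 else int (nat (k mod int p) choose (4 - i)))"
  (is "phi9_action p p ?F")
proof
  show "?F i k = 0" if "i = 0 \<or> 4 < i" for i k using that by simp
  show "?F i k = ?F i k'" if "[k = k'] (mod int p)" for i k k'
    using that by (simp add: cong_def)
  show "[?F i (k + 1) - ?F i k = ?F (Suc i) k] (mod int p)" if i: "i \<in> {1..4}" for i k
  proof (cases "i = 4")
    case False
    define r n where "r = 3 - i" and "n = nat (k mod int p)"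
    have r: "4 - i = Suc r" "3 - i = r" "Suc r < p"
      using i False p(2) by (auto simp: r_def)
    have kn: "k mod int p = int n" and n: "n < p" using p(2) by (simp_all add: n_def nat_less_iff)
    have k1: "(k + 1) mod int p = (int n + 1) mod int p" by (simp flip: kn add: mod_add_left_eq)
    show ?thesis
    proof (cases "Suc n = p")
      case True
      then have k1': "(k + 1) mod int p = 0" using k1 by (simp flip: of_nat_Suc add: add.commute)
      \<comment> \<open>At the wrap-around the next value is \<open>0 choose Suc r = 0\<close>. By
        Pascal's rule the defect is \<open>p choose Suc r\<close>, a multiple of \<open>p\<close>;
        this requires \<open>Suc r < p\<close>.\<close>
      have "p dvd p choose Suc r" using p(1) r(3) by (intro dvd_choose_prime) auto
      then have "int p dvd int ((n choose r) + (n choose Suc r))"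
        unfolding True[symmetric] binomial_Suc_Suc by (simp only: int_dvd_int_iff)
      then have "[int ((n choose r) + (n choose Suc r)) = 0] (mod int p)" by (simp add: cong_0_iff)
      then have "[- int (n choose Suc r) = int (n choose r)] (mod int p)"
        by (simp add: cong_iff_dvd_diff dvd_diff_commute)
      then show ?thesis using i False by (simp add: k1' kn r)
    next
      case False
      then have "nat ((k + 1) mod int p) = Suc n" using k1 n by simp
      then show ?thesis using i \<open>i \<noteq> 4\<close> by (simp add: kn r)
    qed
  qed simp
  show "[(\<Sum>j<p. int (p choose (j + 1)) * ?F (i + j) k) = 0] (mod int p)" if "i \<in> {1..4}" for i k
  proof -
    have "int p dvd int (p choose (j + 1)) * ?F (i + j) k" if "j < p" for j
    proof (cases "j + 1 < p")
      case True
      then have "p dvd p choose (j + 1)" using p(1) by (intro dvd_choose_prime) auto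
      then show ?thesis by (intro dvd_mult2) simp
    next
      case False
      \<comment> \<open>Only the coefficient for \<open>j = p - 1\<close> is not divisible by
        \<open>p\<close>, and it meets a vanishing \<open>F\<close> because
        \<open>i + j \<ge> p \<ge> 5\<close>.\<close>
      then have "4 < i + j" using that \<open>i \<in> {1..4}\<close> p(2) by auto
      then show ?thesis by simp
    qed
    then show ?thesis by (auto simp: cong_0_iff intro!: dvd_sum)
  qed
  show "\<not> [?F 4 0 = 0] (mod int p)" using p(2) by (simp add: cong_def)
qed

lemma phi9_alpha4_nontrivial:
  assumes "prime p" "odd p"
  shows "(ai_word 4, []) \<notin> pres_rel (phi9_relations p)"
proof (cases "p = 3")
  case True
  then show ?thesis using phi9_action.alpha4_nontrivial[OF phi9_action_3] by simp
next
  case False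
  have "p \<noteq> 0" "p \<noteq> 1" "p \<noteq> 2" "p \<noteq> 4" using assms by auto
  then have "5 \<le> p" using False by linarith
  then show ?thesis using phi9_action.alpha4_nontrivial[OF phi9_action_ge_5] assms by blast
qed

section \<open>From the presentation to the abstract description by \<open>a\<close> and the
  \<open>b i\<close>\<close>

lemma phi9_relationsI:
  "i \<in> {1, 2, 3} \<Longrightarrow> (word_comm (ai_word i) a_word, ai_word (Suc i)) \<in> phi9_relations p"
  "(word_comm (ai_word 4) a_word, []) \<in> phi9_relations p"
  "i \<in> {1..4} \<Longrightarrow> j \<in> {1..4} \<Longrightarrow> (word_comm (ai_word i) (ai_word j), []) \<in> phi9_relations p"
  "(word_pow a_word p, []) \<in> phi9_relations p"
  "(ai_paren_word p 1, []) \<in> phi9_relations p"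
  "i \<in> {1, 2, 3} \<Longrightarrow> (ai_paren_word p (Suc i), []) \<in> phi9_relations p"
  unfolding phi9_relations_def Suc_eq_plus1 by blast+

lemma phi9_maximal_class:
  assumes p: "prime p" "odd p"
  shows "maximal_class (phi9_group p) p 4
    (pres_class (phi9_relations p) a_word) (\<lambda>i. pres_class (phi9_relations p) (ai_word (Suc i)))"
proof -
  let ?R = "phi9_relations p"
  let ?c = "pres_class ?R"
  let ?a = "?c a_word" and ?b = "\<lambda>i. ?c (ai_word (Suc i))"
  interpret group "phi9_group p" unfolding phi9_group_def by (rule group_presented_group)
  note closed [simp] = pres_class_closed[of ?R, folded phi9_group_def]
  note Nil = pres_class_Nil[of ?R, folded phi9_group_def]
  note append = pres_class_append[of ?R, folded phi9_group_def]
  note pow = pres_class_pow[of ?R, folded phi9_group_def]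
  note comm = pres_class_comm[of ?R, folded phi9_group_def]
  have b1: "?b i = \<one>\<^bsub>phi9_group p\<^esub>" if "4 \<le> i" for i
    using that by (simp add: ai_word_def Nil)
  show ?thesis
  proof
    show "prime p" by fact
    show "2 \<le> (4 :: nat)" by simp
    show "?a \<in> carrier (phi9_group p)" "?b i \<in> carrier (phi9_group p)" for i by simp_all
    show "?b i \<otimes>\<^bsub>phi9_group p\<^esub> ?b j = ?b j \<otimes>\<^bsub>phi9_group p\<^esub> ?b i" for i j
    proof (cases "i < 4 \<and> j < 4")
      case True
      then have "(word_comm (ai_word (Suc i)) (ai_word (Suc j)), []) \<in> ?R"
        by (intro phi9_relationsI) auto
      from pres_class_relation[OF this] show ?thesis by (simp add: comm Nil commutator_eq_one_iff)
    next
      case False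
      then show ?thesis using b1[of i] b1[of j] by auto
    qed
    show "?b i \<otimes>\<^bsub>phi9_group p\<^esub> ?a = ?a \<otimes>\<^bsub>phi9_group p\<^esub> ?b i \<otimes>\<^bsub>phi9_group p\<^esub> ?b (Suc i)" for i
    proof (cases "i < 4")
      case True
      have "(word_comm (ai_word (Suc i)) a_word, ai_word (Suc (Suc i))) \<in> ?R"
      proof (cases "i = 3")
        case True
        then show ?thesis using phi9_relationsI(2)[of p] by (simp add: ai_word_def)
      next
        case False
        then have "Suc i \<in> {1, 2, 3}" using \<open>i < 4\<close> by auto
        then show ?thesis by (rule phi9_relationsI)
      qed
      from pres_class_relation[OF this]
      have "inv\<^bsub>phi9_group p\<^esub> (?a \<otimes>\<^bsub>phi9_group p\<^esub> ?b i) \<otimes>\<^bsub>phi9_group p\<^esub> (?b i \<otimes>\<^bsub>phi9_group p\<^esub> ?a) = ?b (Suc i)"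
        by (simp add: comm commutator_eq)
      then have "?a \<otimes>\<^bsub>phi9_group p\<^esub> ?b i \<otimes>\<^bsub>phi9_group p\<^esub> ?b (Suc i) = ?a \<otimes>\<^bsub>phi9_group p\<^esub> ?b i
          \<otimes>\<^bsub>phi9_group p\<^esub> (inv\<^bsub>phi9_group p\<^esub> (?a \<otimes>\<^bsub>phi9_group p\<^esub> ?b i) \<otimes>\<^bsub>phi9_group p\<^esub> (?b i \<otimes>\<^bsub>phi9_group p\<^esub> ?a))"
        by simp
      also have "\<dots> = ?b i \<otimes>\<^bsub>phi9_group p\<^esub> ?a" by (simp add: m_assoc[symmetric] del: inv_mult_group)
      finally show ?thesis ..
    next
      case False
      then show ?thesis using b1 by simp
    qed
    show "?b i = \<one>\<^bsub>phi9_group p\<^esub>" if "4 \<le> i" for i by (rule b1[OF that])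
    show "?b (4 - 1) \<noteq> \<one>\<^bsub>phi9_group p\<^esub>"
      using phi9_alpha4_nontrivial[OF p] pres_class_eq_iff[of ?R "ai_word 4" "[]"]
      by (simp add: Nil)
    show "?a [^]\<^bsub>phi9_group p\<^esub> p = \<one>\<^bsub>phi9_group p\<^esub>"
      using pres_class_relation[OF phi9_relationsI(4)[of p]] by (simp add: pow Nil)
    show "?b i [^]\<^bsub>phi9_group p\<^esub> p \<in> generate (phi9_group p) (?b ` {Suc i..})" for i
    proof (cases "i < 4")
      case True
      let ?K = "generate (phi9_group p) (?b ` {Suc i..})"
      have K: "subgroup ?K (phi9_group p)" by (rule generate_is_subgroup) auto
      let ?w = "\<lambda>k. word_pow (ai_word (Suc i + k)) (p choose (k + 1))"
      let ?rest = "concat (map ?w [1..<p])"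
      have "(ai_paren_word p (Suc i), []) \<in> ?R"
      proof (cases "i = 0")
        case False
        then have "i \<in> {1, 2, 3}" using True by auto
        then show ?thesis by (rule phi9_relationsI)
      qed (use phi9_relationsI(5) in simp)
      \<comment> \<open>As \<open>p choose 1 = p\<close>, the leading factor of the power relation
        is the \<open>p\<close>-th power of \<open>b i\<close>; the rest is a product of powers of
        later terms.\<close>
      moreover have "ai_paren_word p (Suc i) = word_pow (ai_word (Suc i)) p @ ?rest"
        using prime_gt_0_nat[OF p(1)] by (simp add: ai_paren_word_def upt_conv_Cons)
      ultimately have "?b i [^]\<^bsub>phi9_group p\<^esub> p \<otimes>\<^bsub>phi9_group p\<^esub> ?c ?rest = \<one>\<^bsub>phi9_group p\<^esub>"
        using pres_class_relation[of "ai_paren_word p (Suc i)" "[]" ?R] by (simp add: append pow Nil)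
      then have "?b i [^]\<^bsub>phi9_group p\<^esub> p = inv\<^bsub>phi9_group p\<^esub> (?c ?rest)"
        using inv_equality by simp
      moreover have "?c ?rest \<in> ?K"
      proof (rule pres_class_concat[of _ ?R, folded phi9_group_def, OF K])
        fix w assume "w \<in> set (map ?w [1..<p])"
        then obtain k where k: "1 \<le> k" "w = ?w k" by auto
        have "?b (i + k) \<in> ?K" using k by (intro generate.incl) auto
        then have "?b (i + k) [^]\<^bsub>phi9_group p\<^esub> int (p choose (k + 1)) \<in> ?K"
          by (rule subgroup_int_pow_closed[OF K])
        then show "?c w \<in> ?K" using k by (simp add: pow int_pow_int)
      qed
      ultimately show ?thesis using subgroup.m_inv_closed[OF K] by simp
    next
      case False
      then show ?thesis using b1 by (simp add: generate.one)
    qed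
    have "?c [(x, False)] \<in> insert ?a (range ?b)" for x
    proof -
      have "[(x, False)] \<in> {a_word, ai_word (Suc 0), ai_word (Suc 1), ai_word (Suc 2), ai_word (Suc 3)}"
        by (cases x) (simp_all add: a_word_def ai_word_def)
      then have "?c [(x, False)] \<in> {?a, ?b 0, ?b 1, ?b 2, ?b 3}"
        by (elim insertE) (simp_all add: numeral_eq_Suc)
      then show ?thesis by blast
    qed
    then have "range (\<lambda>x. ?c [(x, False)]) \<subseteq> insert ?a (range ?b)" by blast
    then show "carrier (phi9_group p) \<subseteq> generate (phi9_group p) (insert ?a (range ?b))"
      using presented_group_generated[of ?R, folded phi9_group_def] mono_generate by simp
  qed
qed

section \<open>Transfer to the whole isoclinism family\<close>

theorem lemma5p8:
  fixes G :: "('a, 'b) monoid_scheme" and p m :: nat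
  assumes "prime p" and "odd p"
    and "group G" and "Coset.order G = p ^ m"
    and "family_rank p G = 5"
    and "in_phi9 p G"
  shows "(fps_compose (A_series G) (fps_const (1 / of_nat (Coset.order G)) * fps_X) =
      fps_const (1 - 1 / of_nat p) / (1 - fps_const (1 / of_nat p ^ 3) * fps_X)
      + fps_const (1 / of_nat p - 1 / of_nat p ^ 4) / (1 - fps_const (1 / of_nat p) * fps_X)
      + fps_const (1 / of_nat p ^ 4) / (1 - fps_X)) \<and>
    (fps_compose (B_series G) (fps_const (1 / of_nat (Coset.order G)) * fps_X) =
      fps_const (- (1 / of_nat p)) / (1 - fps_const (1 / of_nat p ^ 4) * fps_X)
      + 1 / (1 - fps_const (1 / of_nat p ^ 3) * fps_X)
      + fps_const (1 / of_nat p) / (1 - fps_const (1 / of_nat p) * fps_X))"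
proof -
  interpret H: maximal_class "phi9_group p" p 4
    "pres_class (phi9_relations p) a_word" "\<lambda>i. pres_class (phi9_relations p) (ai_word (Suc i))"
    by (rule phi9_maximal_class) fact+
  have p0: "p > 0" using \<open>prime p\<close> by (rule prime_gt_0_nat)
  have finG: "finite (carrier G)"
    using assms(4) p0 card_ge_0_finite[of "carrier G"] by (simp add: order_def)
  have finH: "finite (carrier (phi9_group p))"
    using H.order_eq p0 card_ge_0_finite[of "carrier (phi9_group p)"] by (simp add: order_def)
  have iso: "isoclinic G (phi9_group p)" using assms(6) by (simp add: in_phi9_def)
  \<comment> \<open>The subgroup to be transported to \<open>G\<close> is \<open>H.B 0\<close>,
    generated by the \<alpha>_i; containing the center makes it a union of cosets of the
    center.\<close>
  have ZB: "center (phi9_group p) \<subseteq> H.B 0"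
    unfolding H.center_eq by (rule H.B_antimono) simp
  obtain A where A: "subgroup A G"
    and A_commute: "\<And>x y. x \<in> A \<Longrightarrow> y \<in> A \<Longrightarrow> x \<otimes>\<^bsub>G\<^esub> y = y \<otimes>\<^bsub>G\<^esub> x"
    and cardA': "card A * card (center (phi9_group p)) = card (center G) * card (H.B 0)"
    and orderG': "order G * card (center (phi9_group p)) = card (center G) * order (phi9_group p)"
  proof (rule isoclinic_abelian_subgroup[OF \<open>group G\<close> H.is_group finG finH iso H.subgroup_B ZB])
    show "x \<otimes>\<^bsub>phi9_group p\<^esub> y = y \<otimes>\<^bsub>phi9_group p\<^esub> x" if "x \<in> H.B 0" "y \<in> H.B 0" for x y
      by (rule H.B_commute[OF that])
  qed (rule that)
  \<comment> \<open>In the presented group the center, the subgroup \<open>H.B 0\<close> and the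
    whole group have orders \<open>p\<close>, \<open>p ^ 4\<close> and \<open>p ^ 5\<close>.\<close>
  have cardA: "card A * p = card (center G) * p ^ 4"
    using cardA' H.card_B[of 0] H.card_center by simp
  have orderG: "order G * p = card (center G) * p ^ 5"
    using orderG' H.card_center H.order_eq by (simp add: eval_nat_numeral)
  have index: "order G = p ^ 4 * card (center G)"
    using orderG p0 by (simp add: eval_nat_numeral)
  interpret G: group G by fact
  interpret G: abelian_maximal_rank5 G p m A
  proof
    show "center G \<noteq> carrier G"
    proof
      assume "center G = carrier G"
      \<comment> \<open>An abelian \<open>G\<close> would have a center of index 1 instead of
        \<open>p ^ 4\<close>.\<close>
      then have "card (carrier G) = p ^ 4 * card (carrier G)"
        using index unfolding order_def by metis
      moreover have "card (carrier G) > 0" using finG by (auto simp: card_gt_0_iff)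
      moreover have "1 < p ^ 4" using prime_gt_1_nat[OF \<open>prime p\<close>] by (rule one_less_power) simp
      ultimately show False using n_less_m_mult_n[of "card (carrier G)" "p ^ 4"] by linarith
    qed
    show "order G = p * card A" using cardA orderG p0 by (simp add: eval_nat_numeral)
  qed (use assms A_commute index subgroup.subset[OF A] subgroup.m_closed[OF A]
    subgroup.one_closed[OF A] subgroup.m_inv_closed[OF A] in simp_all)
  show ?thesis using G.series_formulas by blast
qed

end
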